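(* Let $G$ be a countable discrete group, let $X$ be a compact Hausdorff space, and let $G$ act on $X$ by homeomorphisms. If the reduced crossed product $C^*$-algebra $G\ltimes_r C(X)$ is simple (i.e. has no non-zero proper closed two-sided ideals), then there exists a point $x_0\in X$ such that the stabilizer subgroup $G_{x_0}=\{g\in G: gx_0=x_0\}$ has trivial amenable radical.
   Context: The amenable radical $R_a(H)$ of a group $H$ is its largest amenable normal subgroup (the subgroup generated by all amenable normal subgroups of $H$, which is itself amenable and normal). "Trivial amenable radical" means $R_a(H)=\{e\}$. *)

theory Defs
  imports "HOL-Analysis.Analysis"
begin

section \<open>Groups (type class group_add, possibly non-abelian, written additively)\<close>

definition subgrp :: "'g::group_add set \<Rightarrow> bool" where
  "subgrp H \<longleftrightarrow> 0 \<in> H \<and> (\<forall>a\<in>H. \<forall>b\<in>H. a + b \<in> H) \<and> (\<forall>a\<in>H. - a \<in> H)"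

definition normal_subgrp :: "'g::group_add set \<Rightarrow> 'g set \<Rightarrow> bool" where
  "normal_subgrp N H \<longleftrightarrow> subgrp N \<and> N \<subseteq> H \<and> (\<forall>h\<in>H. \<forall>n\<in>N. h + n - h \<in> N)"

text \<open>A subgroup H is amenable iff it admits a left-invariant mean on the bounded
  real functions on H (functions are given on the whole type, only values on H matter).\<close>
definition amenable_subgrp :: "'g::group_add set \<Rightarrow> bool" where
  "amenable_subgrp H \<longleftrightarrow> subgrp H \<and>
     (\<exists>m :: ('g \<Rightarrow> real) \<Rightarrow> real.
        (\<forall>f f'. (\<forall>h\<in>H. f h = f' h) \<longrightarrow> m f = m f') \<and>
        (\<forall>f1 f2 a b. bounded (f1 ` H) \<and> bounded (f2 ` H) \<longrightarrow>
             m (\<lambda>h. a * f1 h + b * f2 h) = a * m f1 + b * m f2) \<and>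
        (\<forall>f. bounded (f ` H) \<and> (\<forall>h\<in>H. 0 \<le> f h) \<longrightarrow> 0 \<le> m f) \<and>
        m (\<lambda>_. 1) = 1 \<and>
        (\<forall>g\<in>H. \<forall>f. bounded (f ` H) \<longrightarrow> m (\<lambda>h. f (g + h)) = m f))"

definition amenable_radical :: "'g::group_add set \<Rightarrow> 'g set" where
  "amenable_radical H =
     \<Inter> {K. subgrp K \<and> \<Union> {N. normal_subgrp N H \<and> amenable_subgrp N} \<subseteq> K}"

definition stabilizer :: "('g \<Rightarrow> 'x \<Rightarrow> 'x) \<Rightarrow> 'x \<Rightarrow> 'g set" where
  "stabilizer act x = {g. act g x = x}"

definition l2 :: "('a \<Rightarrow> complex) set" where
  "l2 = {\<xi>. (\<lambda>p. (cmod (\<xi> p))\<^sup>2) summable_on UNIV}"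

definition l2norm :: "('a \<Rightarrow> complex) \<Rightarrow> real" where
  "l2norm \<xi> = sqrt (\<Sum>\<^sub>\<infinity>p. (cmod (\<xi> p))\<^sup>2)"

text \<open>Operators are represented as functions on all of 'a => complex which vanish
  outside l2 (so that equality of operators is equality of functions).\<close>
definition bounded_op :: "(('a \<Rightarrow> complex) \<Rightarrow> ('a \<Rightarrow> complex)) \<Rightarrow> bool" where
  "bounded_op T \<longleftrightarrow>
     (\<forall>\<xi>. \<xi> \<notin> l2 \<longrightarrow> T \<xi> = (\<lambda>_. 0)) \<and>
     (\<forall>\<xi>\<in>l2. T \<xi> \<in> l2) \<and>
     (\<forall>\<xi>\<in>l2. \<forall>\<eta>\<in>l2. T (\<lambda>p. \<xi> p + \<eta> p) = (\<lambda>p. T \<xi> p + T \<eta> p)) \<and>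
     (\<forall>\<xi>\<in>l2. \<forall>c. T (\<lambda>p. c * \<xi> p) = (\<lambda>p. c * T \<xi> p)) \<and>
     (\<exists>K. \<forall>\<xi>\<in>l2. l2norm (T \<xi>) \<le> K * l2norm \<xi>)"

definition opnorm :: "(('a \<Rightarrow> complex) \<Rightarrow> ('a \<Rightarrow> complex)) \<Rightarrow> real" where
  "opnorm T = Sup {l2norm (T \<xi>) | \<xi>. \<xi> \<in> l2 \<and> l2norm \<xi> \<le> 1}"

definition op_diff :: "(('a \<Rightarrow> complex) \<Rightarrow> ('a \<Rightarrow> complex)) \<Rightarrow> (('a \<Rightarrow> complex) \<Rightarrow> ('a \<Rightarrow> complex))
     \<Rightarrow> (('a \<Rightarrow> complex) \<Rightarrow> ('a \<Rightarrow> complex))" where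
  "op_diff T S = (\<lambda>\<xi> p. T \<xi> p - S \<xi> p)"

definition clean_op :: "(('a \<Rightarrow> complex) \<Rightarrow> ('a \<Rightarrow> complex)) \<Rightarrow> (('a \<Rightarrow> complex) \<Rightarrow> ('a \<Rightarrow> complex))" where
  "clean_op T = (\<lambda>\<xi>. if \<xi> \<in> l2 then T \<xi> else (\<lambda>_. 0))"

section \<open>Reduced crossed product G \<ltimes>_r C(X), via the regular covariant representation
  on l2(G \<times> X) induced from the faithful multiplication representation of C(X) on l2(X)\<close>

text \<open>pi(f) lambda_g, where (lambda_g xi)(h,x) = xi(g^-1 h, x) and
  (pi(f) xi)(h,x) = f(h x) xi(h,x).\<close>
definition covrep :: "('g::group_add \<Rightarrow> 'x \<Rightarrow> 'x) \<Rightarrow> ('x \<Rightarrow> complex) \<Rightarrow> 'g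
     \<Rightarrow> (('g \<times> 'x \<Rightarrow> complex) \<Rightarrow> ('g \<times> 'x \<Rightarrow> complex))" where
  "covrep act f g = clean_op (\<lambda>\<xi> (h, x). f (act h x) * \<xi> (- g + h, x))"

definition crossed_alg :: "('g::group_add \<Rightarrow> 'x::topological_space \<Rightarrow> 'x)
     \<Rightarrow> (('g \<times> 'x \<Rightarrow> complex) \<Rightarrow> ('g \<times> 'x \<Rightarrow> complex)) set" where
  "crossed_alg act =
     {(\<lambda>\<xi> p. \<Sum>i\<in>I. covrep act (F i) (g i) \<xi> p) | I F g.
        finite (I :: nat set) \<and> (\<forall>i\<in>I. continuous_on UNIV (F i))}"

definition reduced_crossed_product :: "('g::group_add \<Rightarrow> 'x::topological_space \<Rightarrow> 'x)
     \<Rightarrow> (('g \<times> 'x \<Rightarrow> complex) \<Rightarrow> ('g \<times> 'x \<Rightarrow> complex)) set" where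
  "reduced_crossed_product act =
     {T. bounded_op T \<and> (\<forall>\<epsilon>>0. \<exists>S\<in>crossed_alg act. opnorm (op_diff T S) < \<epsilon>)}"

definition closed_ideal :: "(('a \<Rightarrow> complex) \<Rightarrow> ('a \<Rightarrow> complex)) set
     \<Rightarrow> (('a \<Rightarrow> complex) \<Rightarrow> ('a \<Rightarrow> complex)) set \<Rightarrow> bool" where
  "closed_ideal A I \<longleftrightarrow> I \<subseteq> A \<and> (\<lambda>_. (\<lambda>_. 0)) \<in> I \<and>
     (\<forall>S\<in>I. \<forall>T\<in>I. (\<lambda>\<xi> p. S \<xi> p + T \<xi> p) \<in> I) \<and>
     (\<forall>S\<in>I. \<forall>c::complex. (\<lambda>\<xi> p. c * S \<xi> p) \<in> I) \<and>
     (\<forall>S\<in>I. \<forall>a\<in>A. a \<circ> S \<in> I \<and> S \<circ> a \<in> I) \<and>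
     (\<forall>T\<in>A. (\<forall>\<epsilon>>0. \<exists>S\<in>I. opnorm (op_diff T S) < \<epsilon>) \<longrightarrow> T \<in> I)"

definition simple_op_algebra :: "(('a \<Rightarrow> complex) \<Rightarrow> ('a \<Rightarrow> complex)) set \<Rightarrow> bool" where
  "simple_op_algebra A \<longleftrightarrow>
     (\<forall>I. closed_ideal A I \<longrightarrow> I = {(\<lambda>_. (\<lambda>_. 0))} \<or> I = A)"

end

theory Submission
  imports Defs
begin

text \<open>
  Suppose that every stabilizer has a nontrivial amenable normal subgroup. At a tame point, i.e. one
  near which each element of its stabilizer acts trivially, an element \<open>g\<close> belonging to
  amenable normal subgroups of stabilizers of points arbitrarily close by belongs to one
  itself: amenability is used only through almost invariant finitely supported means, which is a
  condition on finite subsets. Two applications of Baire's theorem give a tame point \<open>x\<close> and some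
  \<open>g \<noteq> 0\<close> which lies in an amenable normal subgroup of the stabilizer of every tame point of a
  nonempty open set \<open>U\<close>; in particular \<open>g\<close> fixes \<open>U\<close> pointwise. Hence all conjugates \<open>- s + g + s\<close>
  with \<open>s x \<in> U\<close> lie in amenable normal subgroups of the stabilizer of \<open>x\<close>, and there are unit
  vectors \<open>\<xi> n\<close> on this stabilizer asymptotically invariant under all of them. The operators
  vanishing asymptotically on all translates of \<open>\<xi> n \<otimes> \<delta>\<close>, with \<open>\<delta>\<close> the point mass at \<open>x\<close>, form a
  closed ideal, which does not contain the identity but contains \<open>f (1 - \<lambda>_g)\<close> for every
  continuous \<open>f\<close> supported in \<open>U\<close>.
\<close>

section \<open>Finitely supported means\<close>

text \<open>The obstacle is that the set of points whose radical contains a given \<open>g\<close>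
  need not be closed, whereas Baire's theorem controls only closures. At tame points membership
  survives limits, and tameness is invariant under the action, so a single tame \<open>x\<close>
  suffices: every point of its orbit in \<open>U\<close> belongs to the set itself. If the orbit
  misses \<open>U\<close>, the operator simply kills all the vectors.

  Limits also dictate the finitary form of amenability: a limit of amenable subgroups carries no
  evident invariant mean, but each of its finite subsets sits in a nearby subgroup. That form is
  obtained by contraposition: without almost invariant finitely supported means, averaging over a
  finite set contracts l2, its Green function is strictly superharmonic, and an invariant mean
  excludes this.

  The vectors live on the stabilizer of \<open>x\<close> because there a function \<open>f\<close>
  acts on each translate as a scalar. Generators thus permute the translates up to scalars, which
  makes the ideal two-sided.\<close>

definition fin_means :: "'g set \<Rightarrow> (('g \<Rightarrow> real) \<Rightarrow> real) set" where
  "fin_means H = {m. \<exists>A p. finite A \<and> A \<subseteq> H \<and> (\<forall>h\<in>A. 0 \<le> p h) \<and> sum p A = 1 \<and>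
     m = (\<lambda>\<phi>. \<Sum>h\<in>A. p h * \<phi> h)}"

text \<open>Means are kept as functionals, so pushforward and convolution are compositions. Testing
  against all functions bounded by 1 gives an l1 estimate between the density of a finitely
  supported mean and its translate.\<close>

definition almost_inv :: "(('g::group_add \<Rightarrow> real) \<Rightarrow> real) \<Rightarrow> 'g set \<Rightarrow> real \<Rightarrow> bool" where
  "almost_inv m F \<epsilon> \<longleftrightarrow>
     (\<forall>f\<in>F. \<forall>\<phi>. (\<forall>h. \<bar>\<phi> h\<bar> \<le> 1) \<longrightarrow> \<bar>m (\<lambda>h. \<phi> (f + h)) - m \<phi>\<bar> \<le> \<epsilon>)"

text \<open>Reiter's condition, with the mean allowed to live anywhere in the ambient group. Only
  finite subsets enter, so it can be checked by embedding each of them in a set that satisfies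
  it.\<close>

definition reiter :: "'g::group_add set \<Rightarrow> bool" where
  "reiter N \<longleftrightarrow> (\<forall>F \<epsilon>. finite F \<and> F \<subseteq> N \<and> 0 < \<epsilon> \<longrightarrow> (\<exists>m\<in>fin_means UNIV. almost_inv m F \<epsilon>))"

text \<open>\<open>a\<close> need not be injective: the weights over each of its fibres are added
  up. This covers pushforwards and convolutions.\<close>

lemma fin_meansI:
  assumes "finite I" "a ` I \<subseteq> H" "\<And>i. i \<in> I \<Longrightarrow> 0 \<le> w i" "sum w I = 1"
  shows "(\<lambda>\<phi>. \<Sum>i\<in>I. w i * \<phi> (a i)) \<in> fin_means H"
proof -
  define p where "p = (\<lambda>h. \<Sum>i\<in>{i\<in>I. a i = h}. w i)"
  have "sum p (a ` I) = 1"
    unfolding p_def using sum.image_gen[OF assms(1), of w a] assms(4) by simp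
  moreover have "(\<Sum>i\<in>I. w i * \<phi> (a i)) = (\<Sum>h\<in>a ` I. p h * \<phi> h)" for \<phi>
    using sum.image_gen[OF assms(1), of "\<lambda>i. w i * \<phi> (a i)" a]
    by (simp add: p_def sum_distrib_right)
  moreover have "\<forall>h\<in>a ` I. 0 \<le> p h"
    by (auto simp: p_def intro!: sum_nonneg assms(3))
  ultimately show ?thesis
    unfolding fin_means_def using assms(1,2) by (auto intro!: exI[of _ "a ` I"] exI[of _ p])
qed

lemma fin_means_map:
  assumes "m \<in> fin_means UNIV" "range \<psi> \<subseteq> H"
  shows "(\<lambda>\<phi>. m (\<lambda>h. \<phi> (\<psi> h))) \<in> fin_means H"
proof -
  obtain A p where "finite A" "\<forall>h\<in>A. 0 \<le> p h" "sum p A = 1" "m = (\<lambda>\<phi>. \<Sum>h\<in>A. p h * \<phi> h)"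
    using assms(1) unfolding fin_means_def by auto
  then show ?thesis using fin_meansI[of A \<psi> H p] assms(2) by auto
qed

lemma fin_means_conv:
  assumes "finite B" "\<And>b. b \<in> B \<Longrightarrow> 0 \<le> q b" "sum q B = 1" "m \<in> fin_means UNIV"
  shows "(\<lambda>\<phi>. \<Sum>b\<in>B. q b * m (\<lambda>h. \<phi> (b + h))) \<in> fin_means (UNIV :: 'g::group_add set)"
proof -
  obtain A p where A: "finite A" "\<forall>h\<in>A. 0 \<le> p h" "sum p A = 1" "m = (\<lambda>\<phi>. \<Sum>h\<in>A. p h * \<phi> h)"
    using assms(4) unfolding fin_means_def by auto
  have eq: "(\<Sum>b\<in>B. q b * m (\<lambda>h. \<phi> (b + h))) =
      (\<Sum>i\<in>B \<times> A. (q (fst i) * p (snd i)) * \<phi> (fst i + snd i))" for \<phi>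
    by (simp add: A(4) sum_distrib_left sum.cartesian_product case_prod_beta mult.assoc)
  have "(\<Sum>i\<in>B \<times> A. q (fst i) * p (snd i)) = sum q B * sum p A"
    by (simp add: sum_product sum.cartesian_product case_prod_beta)
  then have "(\<lambda>\<phi>. \<Sum>i\<in>B \<times> A. (q (fst i) * p (snd i)) * \<phi> (fst i + snd i)) \<in> fin_means (UNIV :: 'g set)"
    using A assms by (intro fin_meansI) auto
  then show ?thesis by (simp add: eq)
qed

text \<open>Fixing a point in every right coset of \<open>H\<close> gives an \<open>H\<close>-equivariant retraction \<open>G \<rightarrow> H\<close>,
  along which means can be pushed.\<close>
lemma equivariant_retraction:
  assumes "subgrp (H :: 'g::group_add set)"
  obtains \<psi> where "range \<psi> \<subseteq> H" "\<And>k h. k \<in> H \<Longrightarrow> \<psi> (k + h) = k + \<psi> h"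
proof -
  define r where "r = (\<lambda>h. SOME y. h - y \<in> H)"
  have H: "0 \<in> H" "\<And>a b. a \<in> H \<Longrightarrow> b \<in> H \<Longrightarrow> a + b \<in> H" "\<And>a. a \<in> H \<Longrightarrow> - a \<in> H"
    using assms by (auto simp: subgrp_def)
  have r: "h - r h \<in> H" for h
    unfolding r_def by (rule someI[of _ h]) (simp add: H)
  have r_eq: "r (k + h) = r h" if "k \<in> H" for k h
  proof -
    \<comment> \<open>\<open>k + h\<close> and \<open>h\<close> lie in the same right coset, so both
      choices use the same predicate and \<open>SOME\<close> returns the same
      representative.\<close>
    have "k + h - y \<in> H \<longleftrightarrow> h - y \<in> H" for y
    proof
      assume "k + h - y \<in> H"
      then have "- k + (k + h - y) \<in> H" using H that by blast
      moreover have "- k + (k + h - y) = h - y" by (simp only: add_diff_eq[symmetric] minus_add_cancel)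
      ultimately show "h - y \<in> H" by simp
    next
      assume "h - y \<in> H"
      then have "k + (h - y) \<in> H" using H that by blast
      then show "k + h - y \<in> H" by (simp add: add_diff_eq)
    qed
    then show ?thesis by (simp add: r_def)
  qed
  show thesis
  proof
    show "range (\<lambda>h. h - r h) \<subseteq> H" using r by auto
    show "k + h - r (k + h) = k + (h - r h)" if "k \<in> H" for k h
      using r_eq[OF that] by (simp add: add_diff_eq)
  qed
qed

text \<open>The equivariant retraction commutes with translation by elements of \<open>H\<close>, so
  almost invariance survives the pushforward. The gain is control of the support, needed for
  convolutions and for vectors on a stabilizer.\<close>

lemma reiter_fin_means_subgrp:
  fixes H :: "'g::group_add set"
  assumes "reiter N" "subgrp H" "finite F" "F \<subseteq> N" "F \<subseteq> H" "0 < \<epsilon>"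
  obtains m where "m \<in> fin_means H" "almost_inv m F \<epsilon>"
proof -
  obtain m where m: "m \<in> fin_means UNIV" "almost_inv m F \<epsilon>"
    using assms unfolding reiter_def by meson
  obtain \<psi> where \<psi>: "range \<psi> \<subseteq> H" "\<And>k h. k \<in> H \<Longrightarrow> \<psi> (k + h) = k + \<psi> h"
    using equivariant_retraction[OF assms(2)] by blast
  show thesis
  proof
    show "(\<lambda>\<phi>. m (\<lambda>h. \<phi> (\<psi> h))) \<in> fin_means H" by (rule fin_means_map[OF m(1) \<psi>(1)])
    show "almost_inv (\<lambda>\<phi>. m (\<lambda>h. \<phi> (\<psi> h))) F \<epsilon>"
      unfolding almost_inv_def
    proof (intro ballI allI impI)
      fix f and \<phi> :: "'g \<Rightarrow> real" assume f: "f \<in> F" and \<phi>: "\<forall>h. \<bar>\<phi> h\<bar> \<le> 1"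
      have "\<bar>m (\<lambda>h. \<phi> (\<psi> (f + h))) - m (\<lambda>h. \<phi> (\<psi> h))\<bar> \<le> \<epsilon>"
        using m(2)[unfolded almost_inv_def, rule_format, of f "\<lambda>h. \<phi> (\<psi> h)"] f \<phi> by simp
      moreover have "\<psi> (f + h) = f + \<psi> h" for h using \<psi>(2) f assms(5) by auto
      ultimately show "\<bar>m (\<lambda>h. \<phi> (f + \<psi> h)) - m (\<lambda>h. \<phi> (\<psi> h))\<bar> \<le> \<epsilon>" by simp
    qed
  qed
qed

lemma reiter_local:
  assumes "\<And>F. finite F \<Longrightarrow> F \<subseteq> L \<Longrightarrow> \<exists>N. reiter N \<and> F \<subseteq> N"
  shows "reiter L"
  unfolding reiter_def
proof (intro allI impI, elim conjE)
  fix F and \<epsilon> :: real assume F: "finite F" "F \<subseteq> L" "0 < \<epsilon>"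
  then obtain N where "reiter N" "F \<subseteq> N" using assms by blast
  then show "\<exists>m\<in>fin_means UNIV. almost_inv m F \<epsilon>" using F unfolding reiter_def by blast
qed

text \<open>Left translation of the mean by \<open>- s\<close> suffices, because
  \<open>(- s + n + s) + (- s + h) = - s + (n + h)\<close>.\<close>

lemma reiter_conjugate:
  assumes "reiter (N :: 'g::group_add set)"
  shows "reiter ((\<lambda>n. - s + n + s) ` N)"
  unfolding reiter_def
proof (intro allI impI, elim conjE)
  fix F and \<epsilon> :: real
  assume F: "finite F" "F \<subseteq> (\<lambda>n. - s + n + s) ` N" "0 < \<epsilon>"
  then obtain F' where F': "finite F'" "F' \<subseteq> N" "F = (\<lambda>n. - s + n + s) ` F'"
    by (meson finite_subset_image)
  then obtain m where m: "m \<in> fin_means UNIV" "almost_inv m F' \<epsilon>"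
    using assms F(3) unfolding reiter_def by meson
  have "almost_inv (\<lambda>\<phi>. m (\<lambda>h. \<phi> (- s + h))) F \<epsilon>"
    unfolding almost_inv_def
  proof (intro ballI allI impI)
    fix f and \<phi> :: "'g \<Rightarrow> real" assume f: "f \<in> F" and \<phi>: "\<forall>h. \<bar>\<phi> h\<bar> \<le> 1"
    then obtain n where n: "n \<in> F'" "f = - s + n + s" using F' by auto
    have "\<bar>m (\<lambda>h. \<phi> (- s + (n + h))) - m (\<lambda>h. \<phi> (- s + h))\<bar> \<le> \<epsilon>"
      using m(2)[unfolded almost_inv_def, rule_format, of n "\<lambda>h. \<phi> (- s + h)"] n \<phi> by simp
    moreover have "f + (- s + h) = - s + (n + h)" for h
      by (simp add: n add.assoc)
    ultimately show "\<bar>m (\<lambda>h. \<phi> (f + (- s + h))) - m (\<lambda>h. \<phi> (- s + h))\<bar> \<le> \<epsilon>" by simp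
  qed
  moreover have "(\<lambda>\<phi>. m (\<lambda>h. \<phi> (- s + h))) \<in> fin_means UNIV"
    by (rule fin_means_map[OF m(1)]) simp
  ultimately show "\<exists>m\<in>fin_means UNIV. almost_inv m F \<epsilon>" by blast
qed

lemma fin_means_abs_diff_le:
  assumes "finite B" "\<And>b. b \<in> B \<Longrightarrow> 0 \<le> q b" "sum q B = 1"
    and "\<And>b. b \<in> B \<Longrightarrow> \<bar>u b - v b\<bar> \<le> (\<epsilon>::real)"
  shows "\<bar>(\<Sum>b\<in>B. q b * u b) - (\<Sum>b\<in>B. q b * v b)\<bar> \<le> \<epsilon>"
proof -
  have "\<bar>(\<Sum>b\<in>B. q b * u b) - (\<Sum>b\<in>B. q b * v b)\<bar> = \<bar>\<Sum>b\<in>B. q b * (u b - v b)\<bar>"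
    by (simp add: sum_subtractf right_diff_distrib)
  also have "\<dots> \<le> (\<Sum>b\<in>B. q b * \<epsilon>)"
    by (rule order_trans[OF sum_abs], rule sum_mono) (auto simp: abs_mult assms mult_left_mono)
  also have "\<dots> = \<epsilon>" by (simp add: sum_distrib_right[symmetric] assms(3))
  finally show ?thesis .
qed

lemma fin_means_bounded:
  assumes "m \<in> fin_means H" "\<And>h. \<bar>\<phi> h\<bar> \<le> 1"
  shows "\<bar>m \<phi>\<bar> \<le> 1"
proof -
  obtain A p where A: "finite A" "\<forall>h\<in>A. 0 \<le> p h" "sum p A = 1" "m = (\<lambda>\<phi>. \<Sum>h\<in>A. p h * \<phi> h)"
    using assms(1) unfolding fin_means_def by auto
  then show ?thesis using fin_means_abs_diff_le[of A p \<phi> "\<lambda>_. 0" 1] assms(2) by simp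
qed

text \<open>The convolution of a mean on \<open>N2\<close> with a mean that is almost invariant under finitely many
  conjugates of the given elements of \<open>N1\<close>.\<close>
lemma reiter_sum:
  fixes N1 N2 :: "'g::group_add set"
  assumes "reiter N1" "reiter N2" "subgrp N2"
    and conj: "\<And>a b. a \<in> N1 \<Longrightarrow> b \<in> N2 \<Longrightarrow> - b + a + b \<in> N1"
  shows "reiter {a + b | a b. a \<in> N1 \<and> b \<in> N2}"
  unfolding reiter_def
proof (intro allI impI, elim conjE)
  fix F and \<epsilon> :: real
  assume F: "finite F" "F \<subseteq> {a + b | a b. a \<in> N1 \<and> b \<in> N2}" "0 < \<epsilon>"
  then have "\<forall>f\<in>F. \<exists>a b. a \<in> N1 \<and> b \<in> N2 \<and> f = a + b" by blast
  then obtain \<alpha> \<beta> where ab: "\<And>f. f \<in> F \<Longrightarrow> \<alpha> f \<in> N1 \<and> \<beta> f \<in> N2 \<and> f = \<alpha> f + \<beta> f" by metis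
  obtain m2 where m2: "m2 \<in> fin_means N2" "almost_inv m2 (\<beta> ` F) (\<epsilon> / 2)"
    using reiter_fin_means_subgrp[OF assms(2,3), of "\<beta> ` F" "\<epsilon> / 2"] F ab by auto
  then obtain B q where B: "finite B" "B \<subseteq> N2" "\<forall>h\<in>B. 0 \<le> q h" "sum q B = 1"
      "m2 = (\<lambda>\<phi>. \<Sum>h\<in>B. q h * \<phi> h)"
    unfolding fin_means_def by auto
  \<comment> \<open>Moving \<open>\<alpha> f\<close> past a point \<open>b\<close> of the support of
    \<open>m2\<close> conjugates it: \<open>a + b = b + (- b + a + b)\<close>. With
    \<open>m2\<close> fixed first, \<open>m1\<close> faces only finitely many conjugates.\<close>
  define K where "K = (\<lambda>(a, b). - b + a + b) ` (\<alpha> ` F \<times> B)"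
  have "finite K" "K \<subseteq> N1"
    using F B ab conj by (auto simp: K_def)
  then obtain m1 where m1: "m1 \<in> fin_means UNIV" "almost_inv m1 K (\<epsilon> / 2)"
    using assms(1) F(3) unfolding reiter_def by (meson half_gt_zero)
  let ?m = "\<lambda>\<phi>. \<Sum>b\<in>B. q b * m1 (\<lambda>h. \<phi> (b + h))"
  have "?m \<in> fin_means UNIV" using B m1 by (intro fin_means_conv) auto
  moreover have "almost_inv ?m F \<epsilon>"
    unfolding almost_inv_def
  proof (intro ballI allI impI)
    fix f and \<phi> :: "'g \<Rightarrow> real" assume f: "f \<in> F" and \<phi>: "\<forall>h. \<bar>\<phi> h\<bar> \<le> 1"
    have eq: "f = \<alpha> f + \<beta> f" using ab f by blast
    \<comment> \<open>\<open>\<beta> f\<close> is absorbed by \<open>m2\<close> with a test function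
      built from \<open>\<phi>'\<close>, then \<open>\<alpha> f\<close> by \<open>m1\<close>; each
      costs \<open>\<epsilon> / 2\<close>.\<close>
    define \<phi>' where "\<phi>' = (\<lambda>h. \<phi> (\<alpha> f + h))"
    have "\<bar>m2 (\<lambda>b. m1 (\<lambda>h. \<phi>' (\<beta> f + b + h))) - m2 (\<lambda>b. m1 (\<lambda>h. \<phi>' (b + h)))\<bar> \<le> \<epsilon> / 2"
      using m2(2)[unfolded almost_inv_def, rule_format, of "\<beta> f" "\<lambda>b. m1 (\<lambda>h. \<phi>' (b + h))"]
        f \<phi> fin_means_bounded[OF m1(1)] by (simp add: \<phi>'_def)
    moreover have "\<phi>' (\<beta> f + b + h) = \<phi> (f + (b + h))" for b h
      by (subst (2) eq) (simp add: \<phi>'_def add.assoc)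
    ultimately have 1: "\<bar>?m (\<lambda>h. \<phi> (f + h)) - ?m \<phi>'\<bar> \<le> \<epsilon> / 2"
      by (simp add: B(5))
    have "\<bar>?m \<phi>' - ?m \<phi>\<bar> \<le> \<epsilon> / 2"
    proof (rule fin_means_abs_diff_le)
      fix b assume b: "b \<in> B"
      have "- b + \<alpha> f + b \<in> K" using f b by (force simp: K_def)
      moreover have "\<phi>' (b + h) = \<phi> (b + (- b + \<alpha> f + b + h))" for h
        by (simp add: \<phi>'_def add.assoc)
      ultimately show "\<bar>m1 (\<lambda>h. \<phi>' (b + h)) - m1 (\<lambda>h. \<phi> (b + h))\<bar> \<le> \<epsilon> / 2"
        using m1(2)[unfolded almost_inv_def, rule_format, of "- b + \<alpha> f + b" "\<lambda>h. \<phi> (b + h)"] \<phi>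
        by simp
    qed (use B in auto)
    with 1 show "\<bar>?m (\<lambda>h. \<phi> (f + h)) - ?m \<phi>\<bar> \<le> \<epsilon>" by linarith
  qed
  ultimately show "\<exists>m\<in>fin_means UNIV. almost_inv m F \<epsilon>" by blast
qed

section \<open>Amenable groups carry almost invariant finitely supported means\<close>

text \<open>The squared l2 norm as a finite sum. On an infinite support \<open>sum\<close> defaults
  to 0, so finiteness of the support is carried along where the value matters.\<close>

definition sq_sum :: "('g \<Rightarrow> real) \<Rightarrow> real" where
  "sq_sum \<phi> = (\<Sum>h | \<phi> h \<noteq> 0. (\<phi> h)\<^sup>2)"

lemma sq_sum_eq:
  assumes "finite B" "\<And>h. \<phi> h \<noteq> 0 \<Longrightarrow> h \<in> B"
  shows "sq_sum \<phi> = (\<Sum>h\<in>B. (\<phi> h)\<^sup>2)"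
  unfolding sq_sum_def using assms by (intro sum.mono_neutral_left) auto

lemma sq_sum_nonneg: "0 \<le> sq_sum \<phi>"
  unfolding sq_sum_def by (rule sum_nonneg) simp

lemma supp_translate:
  fixes s :: "'g::group_add"
  shows "{h. \<phi> (s + h) \<noteq> 0} = (\<lambda>h. - s + h) ` {h. \<phi> h \<noteq> 0}"
proof -
  have "h \<in> (\<lambda>h. - s + h) ` {h. \<phi> h \<noteq> 0}" if "\<phi> (s + h) \<noteq> 0" for h
    using that by (intro image_eqI[of _ _ "s + h"]) auto
  then show ?thesis by auto
qed

lemma finite_supp_translate:
  fixes s :: "'g::group_add"
  shows "finite {h. \<phi> h \<noteq> 0} \<Longrightarrow> finite {h. \<phi> (s + h) \<noteq> 0}"
  by (simp add: supp_translate)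

lemma sq_sum_translate:
  fixes s :: "'g::group_add"
  shows "sq_sum (\<lambda>h. \<phi> (s + h)) = sq_sum \<phi>"
proof -
  have "(\<Sum>h | \<phi> (s + h) \<noteq> 0. (\<phi> (s + h))\<^sup>2) = (\<Sum>h | \<phi> h \<noteq> 0. (\<phi> (s + (- s + h)))\<^sup>2)"
    unfolding supp_translate by (subst sum.reindex) (auto simp: inj_on_def)
  then show ?thesis by (simp add: sq_sum_def)
qed

lemma sq_le_sq_sum:
  assumes "finite {h. \<phi> h \<noteq> 0}"
  shows "(\<phi> h)\<^sup>2 \<le> sq_sum \<phi>"
proof (cases "\<phi> h = 0")
  case False
  then show ?thesis unfolding sq_sum_def
    using assms by (intro member_le_sum) auto
qed (simp add: sq_sum_nonneg)

text \<open>Cauchy-Schwarz turns failure in l1 into a gap in l2. For the density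
  \<open>(\<phi> h)\<^sup>2 / n\<close> the difference of squares factors as difference times sum,
  and the sum has squared norm at most \<open>4 * n\<close>; hence the constant
  \<open>(\<epsilon> / 2)\<^sup>2\<close>.\<close>

lemma not_almost_inv_imp_sq_sum_ge:
  fixes F :: "'g::group_add set"
  assumes no: "\<And>m. m \<in> fin_means UNIV \<Longrightarrow> \<not> almost_inv m F \<epsilon>" and "0 < \<epsilon>"
    and fin: "finite {h. \<phi> h \<noteq> 0}"
  shows "\<exists>f\<in>F. (\<epsilon> / 2)\<^sup>2 * sq_sum \<phi> \<le> sq_sum (\<lambda>h. \<phi> (f + h) - \<phi> h)"
proof (cases "\<exists>h. \<phi> h \<noteq> 0")
  case False
  then have "\<phi> = (\<lambda>_. 0)" by auto
  \<comment> \<open>A point mass is almost invariant under the empty set, so \<open>F\<close> does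
    have an element to serve as witness.\<close>
  moreover have "(\<lambda>\<phi>. \<Sum>i\<in>{0}. 1 * \<phi> i) \<in> fin_means (UNIV :: 'g set)"
    by (rule fin_meansI[of _ "\<lambda>x. x"]) auto
  then have "F \<noteq> {}" using no by (auto simp: almost_inv_def)
  ultimately show ?thesis by (auto simp: sq_sum_def)
next
  case True
  let ?A = "{h. \<phi> h \<noteq> 0}"
  define n where "n = sq_sum \<phi>"
  have "n > 0"
    using True fin unfolding n_def sq_sum_def by (intro sum_pos) auto
  define p where "p = (\<lambda>h. (\<phi> h)\<^sup>2 / n)"
  have "(\<lambda>\<psi>. \<Sum>h\<in>?A. p h * \<psi> h) \<in> fin_means UNIV"
    using fin \<open>n > 0\<close>
    by (intro fin_meansI) (auto simp: p_def sum_divide_distrib[symmetric] n_def sq_sum_def)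
  from no[OF this] obtain f \<psi> where f: "f \<in> F" and \<psi>: "\<And>h. \<bar>\<psi> h :: real\<bar> \<le> 1"
    and gt: "\<bar>(\<Sum>h\<in>?A. p h * \<psi> (f + h)) - (\<Sum>h\<in>?A. p h * \<psi> h)\<bar> > \<epsilon>"
    unfolding almost_inv_def by (auto simp: not_le)
  define \<phi>' where "\<phi>' = (\<lambda>h. \<phi> (- f + h))"
  define B where "B = ?A \<union> (+) f ` ?A"
  have B: "finite B" using fin by (simp add: B_def)
  have \<phi>'B: "h \<in> B" if "\<phi>' h \<noteq> 0" for h
    using that unfolding B_def \<phi>'_def by (intro UnI2 image_eqI[of _ _ "- f + h"]) auto
  have \<phi>B: "h \<in> B" if "\<phi> h \<noteq> 0" for h using that by (simp add: B_def)
  have "(\<Sum>h\<in>?A. p h * \<psi> (f + h)) = (\<Sum>h\<in>(+) f ` ?A. (\<phi>' h)\<^sup>2 / n * \<psi> h)"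
    by (subst sum.reindex) (auto simp: inj_on_def p_def \<phi>'_def)
  also have "\<dots> = (\<Sum>h\<in>B. (\<phi>' h)\<^sup>2 / n * \<psi> h)"
  proof (rule sum.mono_neutral_left[OF B])
    show "\<forall>h\<in>B - (+) f ` ?A. (\<phi>' h)\<^sup>2 / n * \<psi> h = 0"
    proof
      fix h assume "h \<in> B - (+) f ` ?A"
      then have "\<phi>' h = 0"
        using image_eqI[of h "(+) f" "- f + h" ?A] by (auto simp: \<phi>'_def)
      then show "(\<phi>' h)\<^sup>2 / n * \<psi> h = 0" by simp
    qed
  qed (auto simp: B_def)
  finally have 1: "(\<Sum>h\<in>?A. p h * \<psi> (f + h)) = (\<Sum>h\<in>B. (\<phi>' h)\<^sup>2 / n * \<psi> h)" .
  have 2: "(\<Sum>h\<in>?A. p h * \<psi> h) = (\<Sum>h\<in>B. (\<phi> h)\<^sup>2 / n * \<psi> h)"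
    unfolding p_def by (rule sum.mono_neutral_left[OF B]) (auto simp: B_def)
  define D where "D = sq_sum (\<lambda>h. \<phi>' h - \<phi> h)"
  have D: "D = (\<Sum>h\<in>B. (\<bar>\<phi>' h - \<phi> h\<bar>)\<^sup>2)"
  proof -
    have "h \<in> B" if "\<phi>' h - \<phi> h \<noteq> 0" for h using that \<phi>B[of h] \<phi>'B[of h] by fastforce
    then show ?thesis unfolding D_def power2_abs by (rule sq_sum_eq[OF B])
  qed
  have n': "n = (\<Sum>h\<in>B. (\<phi>' h)\<^sup>2)" "n = (\<Sum>h\<in>B. (\<phi> h)\<^sup>2)"
    using sq_sum_translate[of \<phi> "- f"] sq_sum_eq[OF B, of \<phi>'] sq_sum_eq[OF B, of \<phi>] \<phi>B \<phi>'B
    by (auto simp: \<phi>'_def n_def)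
  have "\<epsilon> * n < \<bar>\<Sum>h\<in>B. ((\<phi>' h)\<^sup>2 - (\<phi> h)\<^sup>2) * \<psi> h\<bar>"
  proof -
    have "(\<Sum>h\<in>B. ((\<phi>' h)\<^sup>2 - (\<phi> h)\<^sup>2) * \<psi> h) / n
        = (\<Sum>h\<in>B. (\<phi>' h)\<^sup>2 / n * \<psi> h) - (\<Sum>h\<in>B. (\<phi> h)\<^sup>2 / n * \<psi> h)"
      by (simp add: sum_divide_distrib sum_subtractf[symmetric] left_diff_distrib diff_divide_distrib)
    then have "\<epsilon> < \<bar>(\<Sum>h\<in>B. ((\<phi>' h)\<^sup>2 - (\<phi> h)\<^sup>2) * \<psi> h) / n\<bar>" using gt 1 2 by simp
    then show ?thesis using \<open>n > 0\<close> by (simp add: abs_divide field_simps)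
  qed
  also have "\<dots> \<le> (\<Sum>h\<in>B. \<bar>\<phi>' h - \<phi> h\<bar> * \<bar>\<phi>' h + \<phi> h\<bar>)"
  proof (rule order_trans[OF sum_abs], rule sum_mono)
    fix h
    have "\<bar>((\<phi>' h)\<^sup>2 - (\<phi> h)\<^sup>2) * \<psi> h\<bar> \<le> \<bar>(\<phi>' h)\<^sup>2 - (\<phi> h)\<^sup>2\<bar> * 1"
      unfolding abs_mult by (intro mult_left_mono \<psi>) simp
    also have "\<dots> = \<bar>\<phi>' h - \<phi> h\<bar> * \<bar>\<phi>' h + \<phi> h\<bar>"
      by (simp add: abs_mult[symmetric] power2_eq_square algebra_simps)
    finally show "\<bar>((\<phi>' h)\<^sup>2 - (\<phi> h)\<^sup>2) * \<psi> h\<bar> \<le> \<bar>\<phi>' h - \<phi> h\<bar> * \<bar>\<phi>' h + \<phi> h\<bar>" .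
  qed
  finally have "(\<epsilon> * n)\<^sup>2 \<le> (\<Sum>h\<in>B. \<bar>\<phi>' h - \<phi> h\<bar> * \<bar>\<phi>' h + \<phi> h\<bar>)\<^sup>2"
    using \<open>\<epsilon> > 0\<close> \<open>n > 0\<close> by (intro power_mono) auto
  also have "\<dots> \<le> D * (\<Sum>h\<in>B. (\<bar>\<phi>' h + \<phi> h\<bar>)\<^sup>2)"
    unfolding D by (rule Cauchy_Schwarz_ineq_sum)
  also have "\<dots> \<le> D * (4 * n)"
  proof (rule mult_left_mono)
    have "(\<Sum>h\<in>B. (\<bar>\<phi>' h + \<phi> h\<bar>)\<^sup>2) \<le> (\<Sum>h\<in>B. 2 * (\<phi>' h)\<^sup>2 + 2 * (\<phi> h)\<^sup>2)"
    proof (rule sum_mono)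
      fix h
      have "0 \<le> (\<phi>' h - \<phi> h)\<^sup>2" by simp
      then show "(\<bar>\<phi>' h + \<phi> h\<bar>)\<^sup>2 \<le> 2 * (\<phi>' h)\<^sup>2 + 2 * (\<phi> h)\<^sup>2"
        by (simp add: power2_eq_square algebra_simps)
    qed
    also have "\<dots> = 4 * n"
      using n' by (simp add: sum.distrib sum_distrib_left[symmetric])
    finally show "(\<Sum>h\<in>B. (\<bar>\<phi>' h + \<phi> h\<bar>)\<^sup>2) \<le> 4 * n" .
    show "0 \<le> D" by (simp add: D_def sq_sum_nonneg)
  qed
  finally have "(\<epsilon> / 2)\<^sup>2 * n \<le> D"
    using \<open>n > 0\<close> by (simp add: power2_eq_square field_simps)
  moreover have "D = sq_sum (\<lambda>h. \<phi> (f + h) - \<phi> h)"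
  proof -
    have "D = sq_sum (\<lambda>h. \<phi>' (f + h) - \<phi> (f + h))"
      unfolding D_def using sq_sum_translate[of "\<lambda>h. \<phi>' h - \<phi> h" f] by simp
    also have "\<dots> = sq_sum (\<lambda>h. \<phi> (f + h) - \<phi> h)"
    proof -
      have "{h. \<phi> h - \<phi> (f + h) \<noteq> 0} = {h. \<phi> (f + h) - \<phi> h \<noteq> 0}" by auto
      then show ?thesis by (simp add: sq_sum_def \<phi>'_def power2_commute)
    qed
    finally show ?thesis .
  qed
  ultimately show ?thesis using f by (auto simp: n_def)
qed

text \<open>Lagrange's identity: the defect in Cauchy-Schwarz is half the sum of all
  \<open>(a s - a t)\<^sup>2\<close>, of which only the pairs \<open>(i, j)\<close> and
  \<open>(j, i)\<close> are kept.\<close>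

lemma sum_square_le_card_minus:
  fixes a :: "'s \<Rightarrow> real"
  assumes "finite S" "i \<in> S" "j \<in> S"
  shows "(\<Sum>s\<in>S. a s)\<^sup>2 \<le> card S * (\<Sum>s\<in>S. (a s)\<^sup>2) - (a i - a j)\<^sup>2"
proof (cases "i = j")
  case True
  then show ?thesis using sum_squared_le_sum_of_squares[of a S] assms(1) by (simp add: mult.commute)
next
  case False
  have "(\<Sum>s\<in>S. \<Sum>t\<in>S. (a s - a t)\<^sup>2)
      = (\<Sum>s\<in>S. \<Sum>t\<in>S. (a s)\<^sup>2 + (a t)\<^sup>2 - 2 * (a s * a t))"
    by (simp add: power2_diff mult.assoc)
  also have "\<dots> = 2 * (card S * (\<Sum>s\<in>S. (a s)\<^sup>2)) - 2 * (\<Sum>s\<in>S. a s)\<^sup>2"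
  proof -
    have "(\<Sum>s\<in>S. a s)\<^sup>2 = (\<Sum>s\<in>S. \<Sum>t\<in>S. a s * a t)"
      by (simp add: power2_eq_square sum_product)
    then show ?thesis by (simp add: sum.distrib sum_subtractf sum_distrib_left)
  qed
  finally have eq: "(\<Sum>s\<in>S. \<Sum>t\<in>S. (a s - a t)\<^sup>2)
      = 2 * (card S * (\<Sum>s\<in>S. (a s)\<^sup>2)) - 2 * (\<Sum>s\<in>S. a s)\<^sup>2" .
  have "(\<Sum>x\<in>{(i, j), (j, i)}. (a (fst x) - a (snd x))\<^sup>2) \<le> (\<Sum>x\<in>S \<times> S. (a (fst x) - a (snd x))\<^sup>2)"
    using assms by (intro sum_mono2) auto
  then have "2 * (a i - a j)\<^sup>2 \<le> (\<Sum>s\<in>S. \<Sum>t\<in>S. (a s - a t)\<^sup>2)"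
    using False by (simp add: sum.cartesian_product case_prod_beta power2_commute[of "a j" "a i"])
  with eq show ?thesis by simp
qed

section \<open>Averaging operators and strictly superharmonic functions\<close>

definition transl_avg :: "'g::group_add set \<Rightarrow> ('g \<Rightarrow> real) \<Rightarrow> 'g \<Rightarrow> real" where
  "transl_avg S \<phi> = (\<lambda>h. (\<Sum>s\<in>S. \<phi> (s + h)) / card S)"

lemma finite_supp_transl_avg:
  assumes "finite S" "finite {h. \<phi> h \<noteq> 0}"
  shows "finite {h. transl_avg S \<phi> h \<noteq> 0}"
proof (rule finite_subset)
  show "{h. transl_avg S \<phi> h \<noteq> 0} \<subseteq> (\<Union>s\<in>S. {h. \<phi> (s + h) \<noteq> 0})"
    by (auto simp: transl_avg_def intro!: sum.neutral)
  show "finite (\<Union>s\<in>S. {h. \<phi> (s + h) \<noteq> 0})"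
    using assms finite_supp_translate by auto
qed

text \<open>The gap along one \<open>f\<close> survives as the Cauchy-Schwarz defect of the average:
  with \<open>0\<close> and \<open>f\<close> in \<open>S\<close>, both \<open>\<phi> h\<close> and
  \<open>\<phi> (f + h)\<close> are among the averaged values.\<close>

lemma sq_sum_transl_avg_le:
  assumes "finite S" "0 \<in> S" "f \<in> S" "finite {h. \<phi> h \<noteq> 0}"
    and "c * sq_sum \<phi> \<le> sq_sum (\<lambda>h. \<phi> (f + h) - \<phi> h)"
  shows "sq_sum (transl_avg S \<phi>) \<le> (1 - c / (card S)\<^sup>2) * sq_sum \<phi>"
proof -
  define B where "B = (\<Union>s\<in>S. {h. \<phi> (s + h) \<noteq> 0})"
  have B: "finite B" using assms(1,4) finite_supp_translate unfolding B_def by auto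
  have k: "card S > 0" using assms by (auto simp: card_gt_0_iff)
  have out: "\<phi> (s + h) = 0" if "h \<notin> B" "s \<in> S" for s h using that by (auto simp: B_def)
  have out0: "\<phi> h = 0" if "h \<notin> B" for h using out[OF that assms(2)] by simp
  have "sq_sum (transl_avg S \<phi>) = (\<Sum>h\<in>B. (transl_avg S \<phi> h)\<^sup>2)"
    by (rule sq_sum_eq[OF B]) (use out in \<open>force simp: transl_avg_def intro: sum.neutral\<close>)
  also have "\<dots> \<le> (\<Sum>h\<in>B. (card S * (\<Sum>s\<in>S. (\<phi> (s + h))\<^sup>2) - (\<phi> (f + h) - \<phi> h)\<^sup>2) / (card S)\<^sup>2)"
  proof (rule sum_mono)
    fix h
    have "(\<Sum>s\<in>S. \<phi> (s + h))\<^sup>2 \<le> card S * (\<Sum>s\<in>S. (\<phi> (s + h))\<^sup>2) - (\<phi> (f + h) - \<phi> h)\<^sup>2"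
      using sum_square_le_card_minus[OF assms(1,3,2), of "\<lambda>s. \<phi> (s + h)"] by simp
    then show "(transl_avg S \<phi> h)\<^sup>2 \<le> (card S * (\<Sum>s\<in>S. (\<phi> (s + h))\<^sup>2) - (\<phi> (f + h) - \<phi> h)\<^sup>2) / (card S)\<^sup>2"
      unfolding transl_avg_def power_divide of_nat_power by (rule divide_right_mono) simp
  qed
  also have "\<dots> = (card S * (\<Sum>s\<in>S. \<Sum>h\<in>B. (\<phi> (s + h))\<^sup>2) - (\<Sum>h\<in>B. (\<phi> (f + h) - \<phi> h)\<^sup>2)) / (card S)\<^sup>2"
    by (subst sum.swap) (simp add: sum_divide_distrib[symmetric] sum_subtractf sum_distrib_left)
  also have "(\<Sum>s\<in>S. \<Sum>h\<in>B. (\<phi> (s + h))\<^sup>2) = (\<Sum>s\<in>S. sq_sum \<phi>)"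
  proof (rule sum.cong[OF refl])
    fix s assume "s \<in> S"
    then have "sq_sum (\<lambda>h. \<phi> (s + h)) = (\<Sum>h\<in>B. (\<phi> (s + h))\<^sup>2)"
      by (intro sq_sum_eq[OF B]) (use out in blast)
    then show "(\<Sum>h\<in>B. (\<phi> (s + h))\<^sup>2) = sq_sum \<phi>" by (simp add: sq_sum_translate)
  qed
  also have "(\<Sum>h\<in>B. (\<phi> (f + h) - \<phi> h)\<^sup>2) = sq_sum (\<lambda>h. \<phi> (f + h) - \<phi> h)"
    by (rule sq_sum_eq[OF B, symmetric]) (use out[OF _ assms(3)] out0 in force)
  also have "(card S * (\<Sum>s\<in>S. sq_sum \<phi>) - sq_sum (\<lambda>h. \<phi> (f + h) - \<phi> h)) / (card S)\<^sup>2
      \<le> (card S * (\<Sum>s\<in>S. sq_sum \<phi>) - c * sq_sum \<phi>) / (card S)\<^sup>2"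
    using assms(5) by (intro divide_right_mono) auto
  also have "\<dots> = (1 - c / (card S)\<^sup>2) * sq_sum \<phi>"
    using k by (simp add: field_simps power2_eq_square)
  finally show ?thesis .
qed

lemma transl_avg_nonneg:
  assumes "\<And>h. 0 \<le> \<phi> h"
  shows "0 \<le> transl_avg S \<phi> h"
  unfolding transl_avg_def using assms by (simp add: sum_nonneg)

text \<open>A spectral gap of the averaging operator \<open>M\<close> makes the Green function \<open>\<Sum>n. t ^ n * M ^ n \<delta>\<close>
  converge for some \<open>t > 1\<close>; a weighted sum over all right translates makes it strictly positive.\<close>
lemma ex_strictly_superharmonic:
  fixes S :: "'g::{group_add, countable} set"
  assumes S: "finite S" "0 \<in> S" and "0 < c"
    and gap: "\<And>\<phi>. finite {h. \<phi> h \<noteq> 0} \<Longrightarrow> \<exists>f\<in>S. c * sq_sum \<phi> \<le> sq_sum (\<lambda>h. \<phi> (f + h) - \<phi> h)"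
  obtains v and t :: real where "1 < t" "\<And>h. 0 < v h" "\<And>h. transl_avg S v h \<le> v h / t"
proof -
  have k: "card S > 0" using S by (auto simp: card_gt_0_iff)
  \<comment> \<open>The maximum with \<open>1 / 2\<close> keeps \<open>\<rho>\<close> positive; its
    iterated square root \<open>q\<close> is inverted below.\<close>
  define \<rho> where "\<rho> = max (1 / 2) (1 - c / (card S)\<^sup>2)"
  have \<rho>: "0 < \<rho>" "\<rho> < 1" using k \<open>0 < c\<close> by (auto simp: \<rho>_def)
  have contr: "sq_sum (transl_avg S \<phi>) \<le> \<rho> * sq_sum \<phi>" if fin: "finite {h. \<phi> h \<noteq> 0}" for \<phi>
  proof -
    obtain f where "f \<in> S" "c * sq_sum \<phi> \<le> sq_sum (\<lambda>h. \<phi> (f + h) - \<phi> h)" using gap[OF fin] by blast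
    then have "sq_sum (transl_avg S \<phi>) \<le> (1 - c / (card S)\<^sup>2) * sq_sum \<phi>"
      using sq_sum_transl_avg_le[OF S _ fin] by blast
    also have "\<dots> \<le> \<rho> * sq_sum \<phi>"
      by (rule mult_right_mono) (auto simp: \<rho>_def sq_sum_nonneg)
    finally show ?thesis .
  qed
  define a where "a = (\<lambda>n. (transl_avg S ^^ n) (\<lambda>h. if h = 0 then 1 else 0))"
  have a0: "a 0 = (\<lambda>h. if h = 0 then 1 else 0)" and aS: "a (Suc n) = transl_avg S (a n)" for n
    by (auto simp: a_def)
  have fin: "finite {h. a n h \<noteq> 0}" for n
    by (induction n) (auto simp: a0 aS intro: finite_supp_transl_avg[OF S(1)])
  have nonneg: "0 \<le> a n h" for n h
    by (induction n arbitrary: h) (auto simp: a0 aS intro: transl_avg_nonneg)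
  have sq: "sq_sum (a n) \<le> \<rho> ^ n" for n
  proof (induction n)
    case 0
    then show ?case by (simp add: a0 sq_sum_def)
  next
    case (Suc n)
    have "sq_sum (a (Suc n)) \<le> \<rho> * sq_sum (a n)" unfolding aS by (rule contr[OF fin])
    also have "\<dots> \<le> \<rho> * \<rho> ^ n" using Suc \<rho> by (intro mult_left_mono) auto
    finally show ?case by simp
  qed
  \<comment> \<open>The l2 bound gives a pointwise one: the square of a value is at most the squared
    norm, hence at most \<open>\<rho> ^ n\<close>.\<close>
  define r where "r = sqrt \<rho>"
  have r: "0 < r" "r < 1" using \<rho> by (auto simp: r_def)
  have a_le: "a n h \<le> r ^ n" for n h
  proof (rule power2_le_imp_le)
    have "(a n h)\<^sup>2 \<le> \<rho> ^ n" using sq_le_sq_sum[OF fin[of n], of h] sq[of n] by linarith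
    also have "\<rho> ^ n = (r ^ n)\<^sup>2" using \<rho> by (simp add: r_def power_mult[symmetric] mult.commute[of n] power_mult)
    finally show "(a n h)\<^sup>2 \<le> (r ^ n)\<^sup>2" .
  qed (use r in auto)
  \<comment> \<open>This places \<open>t\<close> strictly between 1 and \<open>1 / r\<close>, so
    that \<open>t * r = q < 1\<close> makes the Green series converge.\<close>
  define q where "q = sqrt r"
  define t where "t = 1 / q"
  have q: "0 < q" "q < 1" using r by (auto simp: q_def)
  have t: "1 < t" using q by (simp add: t_def)
  have tr: "t * r = q" using q r by (simp add: t_def q_def field_simps)
  have le_q: "t ^ n * a n h \<le> q ^ n" for n h
  proof -
    have "t ^ n * a n h \<le> t ^ n * r ^ n" using t by (intro mult_left_mono a_le) auto
    also have "\<dots> = q ^ n" using tr by (simp add: power_mult_distrib[symmetric])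
    finally show ?thesis .
  qed
  have term_nonneg: "0 \<le> t ^ n * a n h" for n h using t nonneg by simp
  have geo: "summable (\<lambda>n. q ^ n)" using q by (intro summable_geometric) auto
  have summ: "summable (\<lambda>n. t ^ n * a n h)" for h
    using le_q term_nonneg by (intro summable_comparison_test'[OF geo, of 0]) auto
  define u where "u = (\<lambda>h. \<Sum>n. t ^ n * a n h)"
  have u_nonneg: "0 \<le> u h" for h
    unfolding u_def by (rule suminf_nonneg[OF summ term_nonneg])
  have u_le: "u h \<le> (\<Sum>n. q ^ n)" for h
    unfolding u_def by (rule suminf_le[OF le_q summ geo])
  have u0: "1 \<le> u 0"
    using sum_le_suminf[OF summ[of 0], of "{0}"] term_nonneg by (simp add: u_def a0)
  have u_avg: "transl_avg S u h \<le> u h / t" for h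
  proof -
    \<comment> \<open>Averaging shifts the series by one index and yields
      \<open>(u h - a 0 h) / t\<close>; dropping the point mass gives the inequality.\<close>
    have "transl_avg S u h = (\<Sum>n. (\<Sum>s\<in>S. t ^ n * a n (s + h)) / card S)"
      unfolding transl_avg_def u_def using summ
      by (simp add: suminf_sum suminf_divide summable_sum)
    also have "\<dots> = (\<Sum>n. t ^ n * a (Suc n) h)"
      by (simp add: aS transl_avg_def sum_distrib_left)
    also have "\<dots> = (\<Sum>n. t ^ Suc n * a (Suc n) h / t)" using t by simp
    also have "\<dots> = (\<Sum>n. t ^ Suc n * a (Suc n) h) / t"
      using summ[of h] by (intro suminf_divide) (subst summable_Suc_iff)
    also have "\<dots> = (u h - a 0 h) / t"
      using suminf_split_head[OF summ[of h]] by (simp add: u_def)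
    also have "\<dots> \<le> u h / t" using t nonneg[of 0 h] by (intro divide_right_mono) auto
    finally show ?thesis .
  qed
  \<comment> \<open>\<open>u\<close> is known to be positive only at 0. Right translates commute
    with averaging on the left, the translate of index \<open>to_nat h\<close> is positive at
    \<open>h\<close>, and the uniform bound on \<open>u\<close> makes the weighted series
    converge.\<close>
  define w where "w = (\<lambda>n h. (1 / 2) ^ n * u (h - (from_nat n :: 'g)) :: real)"
  have geo2: "summable (\<lambda>n. (1 / 2) ^ n * (\<Sum>n. q ^ n) :: real)"
    by (intro summable_mult2 summable_geometric) auto
  have w_nonneg: "0 \<le> w n h" for n h using u_nonneg by (simp add: w_def)
  have summ2: "summable (\<lambda>n. w n h)" for h
    using u_nonneg u_le by (intro summable_comparison_test'[OF geo2, of 0]) (auto simp: w_def)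
  show thesis
  proof (rule that[OF t])
    show "0 < (\<Sum>n. w n h)" for h
    proof (rule suminf_pos2[OF summ2, of _ "to_nat h"])
      show "0 < w (to_nat h) h" using u0 by (simp add: w_def)
    qed (rule w_nonneg)
    show "transl_avg S (\<lambda>h. \<Sum>n. w n h) h \<le> (\<Sum>n. w n h) / t" for h
    proof -
      have "transl_avg S (\<lambda>h. \<Sum>n. w n h) h = (\<Sum>n. (\<Sum>s\<in>S. w n (s + h)) / card S)"
        unfolding transl_avg_def using summ2 by (simp add: suminf_sum suminf_divide summable_sum)
      also have "\<dots> \<le> (\<Sum>n. w n h / t)"
      proof (rule suminf_le)
        fix n
        have "(\<Sum>s\<in>S. w n (s + h)) / card S = (1 / 2) ^ n * transl_avg S u (h - from_nat n)"
          by (simp add: w_def transl_avg_def sum_distrib_left add_diff_eq)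
        also have "\<dots> \<le> (1 / 2) ^ n * (u (h - from_nat n) / t)"
          by (intro mult_left_mono u_avg) auto
        finally show "(\<Sum>s\<in>S. w n (s + h)) / card S \<le> w n h / t" by (simp add: w_def)
      qed (use summ2 in \<open>auto intro!: summable_divide summable_sum\<close>)
      also have "\<dots> = (\<Sum>n. w n h) / t" by (rule suminf_divide[OF summ2])
      finally show ?thesis .
    qed
  qed
qed

text \<open>Apply the invariant mean to the logarithmic increments of a strictly superharmonic function:
  they are bounded, and the mean of the increment along \<open>- s\<close> is the negative of that along \<open>s\<close>.\<close>
lemma amenable_imp_no_strictly_superharmonic:
  fixes S :: "'g::group_add set"
  assumes N: "amenable_subgrp N" and S: "finite S" "S \<noteq> {}" "S \<subseteq> N" and sym: "uminus ` S = S"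
    and v: "\<And>h. 0 < v h" "\<And>h. transl_avg S v h \<le> v h / t" and t: "1 < (t::real)"
  shows False
proof -
  obtain m :: "('g \<Rightarrow> real) \<Rightarrow> real" where m:
    "\<forall>f1 f2 a b. bounded (f1 ` N) \<and> bounded (f2 ` N) \<longrightarrow>
       m (\<lambda>h. a * f1 h + b * f2 h) = a * m f1 + b * m f2"
    "\<forall>f. bounded (f ` N) \<and> (\<forall>h\<in>N. 0 \<le> f h) \<longrightarrow> 0 \<le> m f"
    "m (\<lambda>_. 1) = 1"
    "\<forall>g\<in>N. \<forall>f. bounded (f ` N) \<longrightarrow> m (\<lambda>h. f (g + h)) = m f"
    using N unfolding amenable_subgrp_def by (elim conjE exE) (rule that)
  have lin: "m (\<lambda>h. a * f1 h + b * f2 h) = a * m f1 + b * m f2"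
    if "bounded (f1 ` N)" "bounded (f2 ` N)" for f1 f2 a b
    using m(1) that by blast
  have pos: "0 \<le> m f" if "bounded (f ` N)" "\<forall>h\<in>N. 0 \<le> f h" for f
    using m(2) that by blast
  have inv: "m (\<lambda>h. f (g + h)) = m f" if "g \<in> N" "bounded (f ` N)" for g f
    using m(4) that by blast
  have k: "card S > 0" using S by (auto simp: card_gt_0_iff)
  define F where "F = (\<lambda>s h. ln (v h) - ln (v (s + h)))"
  \<comment> \<open>A Harnack inequality: one positive value is at most the sum over all neighbours.
    With the symmetry of \<open>S\<close> it bounds the logarithmic increments on both
    sides.\<close>
  have v_le: "v (s + h) \<le> card S * v h" if "s \<in> S" for s h
  proof -
    have "v (s + h) \<le> (\<Sum>s\<in>S. v (s + h))"
      using S that v(1) by (intro member_le_sum) (auto intro: less_imp_le)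
    also have "\<dots> \<le> card S * (v h / t)"
      using v(2)[of h] k by (simp add: transl_avg_def field_simps)
    also have "\<dots> \<le> card S * v h"
      using t v(1)[of h] by (intro mult_left_mono) (auto simp: field_simps)
    finally show ?thesis .
  qed
  have F_ge: "F s h \<ge> - ln (card S)" if "s \<in> S" for s h
  proof -
    have "ln (v (s + h)) \<le> ln (card S * v h)" using v_le[OF that] v(1) k by (subst ln_le_cancel_iff) auto
    also have "\<dots> = ln (card S) + ln (v h)" using v(1)[of h] k by (subst ln_mult_pos) auto
    finally show ?thesis by (simp add: F_def)
  qed
  have F_neg: "F (- s) h = - F s (- s + h)" for s h by (simp add: F_def)
  have F_le: "F s h \<le> ln (card S)" if "s \<in> S" for s h
    using F_ge[of "- s" "s + h"] F_neg[of s "s + h"] sym that by auto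
  have bdd: "bounded (F s ` A)" if "s \<in> S" for s A
    unfolding bounded_iff using F_le[OF that] F_ge[OF that]
    by (intro exI[of _ "ln (card S)"]) (auto simp: abs_le_iff minus_le_iff)
  have sum_bdd: "bounded ((\<lambda>h. \<Sum>s\<in>T. F s h) ` N)" if "finite T" "T \<subseteq> S" for T
    using that
  proof (induction T rule: finite_induct)
    case (insert x T)
    then have "bounded ((\<lambda>h. F x h + (\<Sum>s\<in>T. F s h)) ` N)"
      by (intro bounded_plus_comp) (auto intro: bdd)
    with insert show ?case by simp
  qed (auto simp: bounded_iff intro: exI[of _ 0])
  have m_sum: "m (\<lambda>h. \<Sum>s\<in>T. F s h) = (\<Sum>s\<in>T. m (F s))" if "finite T" "T \<subseteq> S" for T
    using that
  proof (induction T rule: finite_induct)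
    case empty
    show ?case using lin[of "\<lambda>_. 0" "\<lambda>_. 0" 0 0] by (auto simp: bounded_iff)
  next
    case (insert x T)
    have "m (\<lambda>h. 1 * F x h + 1 * (\<Sum>s\<in>T. F s h)) = 1 * m (F x) + 1 * m (\<lambda>h. \<Sum>s\<in>T. F s h)"
      using insert by (intro lin bdd sum_bdd) auto
    with insert show ?case by simp
  qed
  have neg_in: "- s \<in> S" if "s \<in> S" for s using sym that by blast
  have m_neg: "m (F (- s)) = - m (F s)" if "s \<in> S" for s
  proof -
    have "m (F (- s)) = m (\<lambda>h. - 1 * F s (- s + h) + 0 * F s (- s + h))"
      by (rule arg_cong[of _ _ m]) (auto simp: F_neg)
    also have "\<dots> = - m (\<lambda>h. F s (- s + h))"
      using bdd[OF that, of "(+) (- s) ` N"]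
      by (subst lin) (auto simp: image_image)
    also have "m (\<lambda>h. F s (- s + h)) = m (F s)"
      using neg_in[OF that] S(3) by (intro inv bdd[OF that]) auto
    finally show ?thesis .
  qed
  \<comment> \<open>Since \<open>S\<close> is symmetric, reindexing by negation turns the sum into
    its own negative.\<close>
  have "(\<Sum>s\<in>S. m (F s)) = (\<Sum>s\<in>uminus ` S. m (F s))" by (simp add: sym)
  also have "\<dots> = (\<Sum>s\<in>S. m (F (- s)))" by (subst sum.reindex) (auto simp: inj_on_def)
  also have "\<dots> = - (\<Sum>s\<in>S. m (F s))" by (simp add: m_neg sum_negf)
  finally have zero: "(\<Sum>s\<in>S. m (F s)) = 0" by simp
  \<comment> \<open>This is \<open>card S - card S / t\<close>, obtained by applying
    \<open>ln y \<le> y - 1\<close> to the ratios \<open>v (s + h) / v h\<close> and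
    summing.\<close>
  define d where "d = card S * (1 - 1 / t)"
  have "d > 0" using k t by (simp add: d_def)
  have ge_d: "(\<Sum>s\<in>S. F s h) \<ge> d" for h
  proof -
    have "(\<Sum>s\<in>S. 1 - v (s + h) / v h) \<le> (\<Sum>s\<in>S. F s h)"
    proof (rule sum_mono)
      fix s
      have "ln (v (s + h) / v h) \<le> v (s + h) / v h - 1" using v(1) by (intro ln_le_minus_one) auto
      moreover have "ln (v (s + h) / v h) = ln (v (s + h)) - ln (v h)"
        using v(1)[of h] v(1)[of "s + h"] by (subst ln_divide_pos) auto
      ultimately show "1 - v (s + h) / v h \<le> F s h" by (simp add: F_def)
    qed
    moreover have "(\<Sum>s\<in>S. 1 - v (s + h) / v h) = card S - (\<Sum>s\<in>S. v (s + h)) / v h"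
      by (simp add: sum_subtractf sum_divide_distrib)
    moreover have "(\<Sum>s\<in>S. v (s + h)) / v h \<le> card S / t"
      using v(2)[of h] v(1)[of h] k t by (simp add: transl_avg_def field_simps)
    ultimately show ?thesis by (simp add: d_def right_diff_distrib)
  qed
  have "0 \<le> m (\<lambda>h. 1 * (\<Sum>s\<in>S. F s h) + (- d) * 1)"
  proof (rule pos)
    show "bounded ((\<lambda>h. 1 * (\<Sum>s\<in>S. F s h) + (- d) * 1) ` N)"
      using sum_bdd[OF S(1)] by (intro bounded_plus_comp) (auto simp: bounded_iff)
  qed (use ge_d in auto)
  also have "\<dots> = 1 * m (\<lambda>h. \<Sum>s\<in>S. F s h) + (- d) * m (\<lambda>_. 1)"
    using sum_bdd[OF S(1)] by (intro lin) (auto simp: bounded_iff)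
  also have "\<dots> = - d" using m_sum[OF S(1)] zero m(3) by simp
  finally show False using \<open>d > 0\<close> by simp
qed

text \<open>Without such means there is an l2 gap along \<open>F\<close>, hence a strictly
  superharmonic function for the average over a symmetrised \<open>F\<close>, which the invariant
  mean excludes. Countability enters through the weighted sum over right translates.\<close>

lemma amenable_imp_reiter:
  fixes N :: "'g::{group_add, countable} set"
  assumes "amenable_subgrp N"
  shows "reiter N"
  unfolding reiter_def
proof (intro allI impI, elim conjE, rule ccontr)
  fix F and \<epsilon> :: real
  assume F: "finite F" "F \<subseteq> N" "0 < \<epsilon>" and "\<not> (\<exists>m\<in>fin_means UNIV. almost_inv m F \<epsilon>)"
  then have no: "\<And>m. m \<in> fin_means UNIV \<Longrightarrow> \<not> almost_inv m F \<epsilon>" by blast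
  \<comment> \<open>Symmetry makes the increments cancel under the mean; \<open>0\<close> supplies
    the reference value in the l2 gap.\<close>
  define S where "S = insert 0 (F \<union> uminus ` F)"
  have "subgrp N" using assms by (simp add: amenable_subgrp_def)
  then have S: "finite S" "S \<subseteq> N" "0 \<in> S" "uminus ` S = S"
    using F by (auto simp: S_def subgrp_def image_Un image_image)
  obtain v t where "1 < (t::real)" "\<And>h. 0 < v h" "\<And>h. transl_avg S v h \<le> v h / t"
  proof (rule ex_strictly_superharmonic[OF S(1,3), of "(\<epsilon> / 2)\<^sup>2"])
    show "\<exists>f\<in>S. (\<epsilon> / 2)\<^sup>2 * sq_sum \<phi> \<le> sq_sum (\<lambda>h. \<phi> (f + h) - \<phi> h)" if "finite {h. \<phi> h \<noteq> 0}" for \<phi>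
      using not_almost_inv_imp_sq_sum_ge[OF no F(3) that] by (auto simp: S_def)
  qed (use F in auto)
  then show False using amenable_imp_no_strictly_superharmonic[OF assms S(1) _ S(2,4)] S(3) by blast
qed

section \<open>Operators on square-summable functions\<close>

lemma L2_set_le_l2norm:
  assumes "\<xi> \<in> l2" "finite A"
  shows "L2_set (\<lambda>p. cmod (\<xi> p)) A \<le> l2norm \<xi>"
  unfolding L2_set_def l2norm_def
  using assms by (intro real_sqrt_le_mono finite_sum_le_infsum) (auto simp: l2_def)

text \<open>Norm estimates reduce to finite subsets, where the inequalities for
  \<open>L2_set\<close> apply.\<close>

lemma
  assumes "\<And>A. finite A \<Longrightarrow> L2_set (\<lambda>p. cmod (\<xi> p)) A \<le> c"
  shows l2_I: "\<xi> \<in> l2" and l2norm_leI: "l2norm \<xi> \<le> c"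
proof -
  have c: "0 \<le> c" using assms[of "{}"] by simp
  have le: "(\<Sum>p\<in>A. (cmod (\<xi> p))\<^sup>2) \<le> c\<^sup>2" if "finite A" for A
    using assms[OF that] c unfolding L2_set_def by (simp add: sqrt_le_D)
  show "\<xi> \<in> l2" unfolding l2_def
    using le by (auto intro!: nonneg_bdd_above_summable_on bdd_aboveI[of _ "c\<^sup>2"])
  then have "(\<Sum>\<^sub>\<infinity>p. (cmod (\<xi> p))\<^sup>2) \<le> c\<^sup>2"
    using le by (intro infsum_le_finite_sums) (auto simp: l2_def)
  then show "l2norm \<xi> \<le> c"
    unfolding l2norm_def using c by (simp add: real_le_lsqrt infsum_nonneg)
qed

lemma l2norm_nonneg: "0 \<le> l2norm \<xi>"
  unfolding l2norm_def by (simp add: infsum_nonneg)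

lemma
  assumes "\<xi> \<in> l2" "\<eta> \<in> l2"
  shows l2_add: "(\<lambda>p. \<xi> p + \<eta> p) \<in> l2"
    and l2norm_triangle: "l2norm (\<lambda>p. \<xi> p + \<eta> p) \<le> l2norm \<xi> + l2norm \<eta>"
proof -
  have *: "L2_set (\<lambda>p. cmod (\<xi> p + \<eta> p)) A \<le> l2norm \<xi> + l2norm \<eta>" if "finite A" for A
  proof -
    have "L2_set (\<lambda>p. cmod (\<xi> p + \<eta> p)) A \<le> L2_set (\<lambda>p. cmod (\<xi> p) + cmod (\<eta> p)) A"
      by (rule L2_set_mono) (auto intro: norm_triangle_ineq)
    also have "\<dots> \<le> L2_set (\<lambda>p. cmod (\<xi> p)) A + L2_set (\<lambda>p. cmod (\<eta> p)) A"
      by (rule L2_set_triangle_ineq)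
    also have "\<dots> \<le> l2norm \<xi> + l2norm \<eta>"
      using L2_set_le_l2norm[OF assms(1) that] L2_set_le_l2norm[OF assms(2) that] by linarith
    finally show ?thesis .
  qed
  show "(\<lambda>p. \<xi> p + \<eta> p) \<in> l2" by (rule l2_I[OF *])
  show "l2norm (\<lambda>p. \<xi> p + \<eta> p) \<le> l2norm \<xi> + l2norm \<eta>" by (rule l2norm_leI[OF *])
qed

lemma
  assumes "\<xi> \<in> l2"
  shows l2_cmult: "(\<lambda>p. c * \<xi> p) \<in> l2"
    and l2norm_cmult: "l2norm (\<lambda>p. c * \<xi> p) = cmod c * l2norm \<xi>"
proof -
  have "(\<lambda>p. (cmod c)\<^sup>2 * (cmod (\<xi> p))\<^sup>2) summable_on UNIV"
    using assms by (intro summable_on_cmult_right) (simp add: l2_def)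
  then show "(\<lambda>p. c * \<xi> p) \<in> l2" by (simp add: l2_def norm_mult power_mult_distrib)
  show "l2norm (\<lambda>p. c * \<xi> p) = cmod c * l2norm \<xi>"
    by (simp add: l2norm_def norm_mult power_mult_distrib infsum_cmult_right' real_sqrt_mult)
qed

lemma l2_zero: "(\<lambda>_. 0) \<in> l2"
  and l2norm_zero: "l2norm (\<lambda>_. 0) = 0"
  by (auto simp: l2_def l2norm_def)

lemma
  assumes "\<xi> \<in> l2" "\<eta> \<in> l2"
  shows l2_diff: "(\<lambda>p. \<xi> p - \<eta> p) \<in> l2"
    and l2norm_triangle_sub: "l2norm \<xi> \<le> l2norm \<eta> + l2norm (\<lambda>p. \<xi> p - \<eta> p)"
proof -
  show d: "(\<lambda>p. \<xi> p - \<eta> p) \<in> l2"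
    using l2_add[OF assms(1) l2_cmult[OF assms(2), of "-1"]] by simp
  show "l2norm \<xi> \<le> l2norm \<eta> + l2norm (\<lambda>p. \<xi> p - \<eta> p)"
    using l2norm_triangle[OF assms(2) d] by simp
qed

lemma
  assumes "finite I" "\<And>i. i \<in> I \<Longrightarrow> \<xi> i \<in> l2"
  shows l2_sum: "(\<lambda>p. \<Sum>i\<in>I. \<xi> i p) \<in> l2"
    and l2norm_sum: "l2norm (\<lambda>p. \<Sum>i\<in>I. \<xi> i p) \<le> (\<Sum>i\<in>I. l2norm (\<xi> i))"
proof -
  have "(\<lambda>p. \<Sum>i\<in>I. \<xi> i p) \<in> l2 \<and> l2norm (\<lambda>p. \<Sum>i\<in>I. \<xi> i p) \<le> (\<Sum>i\<in>I. l2norm (\<xi> i))"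
    using assms
  proof (induction I rule: finite_induct)
    case (insert x I)
    then have *: "\<xi> x \<in> l2" "(\<lambda>p. \<Sum>i\<in>I. \<xi> i p) \<in> l2"
      "l2norm (\<lambda>p. \<Sum>i\<in>I. \<xi> i p) \<le> (\<Sum>i\<in>I. l2norm (\<xi> i))" by auto
    then show ?case using insert l2_add[OF *(1,2)] l2norm_triangle[OF *(1,2)] by simp
  qed (simp add: l2_zero l2norm_zero)
  then show "(\<lambda>p. \<Sum>i\<in>I. \<xi> i p) \<in> l2" "l2norm (\<lambda>p. \<Sum>i\<in>I. \<xi> i p) \<le> (\<Sum>i\<in>I. l2norm (\<xi> i))" by auto
qed

lemma bounded_opD:
  assumes "bounded_op T"
  shows "\<xi> \<notin> l2 \<Longrightarrow> T \<xi> = (\<lambda>_. 0)"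
    and "\<xi> \<in> l2 \<Longrightarrow> T \<xi> \<in> l2"
    and "\<xi> \<in> l2 \<Longrightarrow> \<eta> \<in> l2 \<Longrightarrow> T (\<lambda>p. \<xi> p + \<eta> p) = (\<lambda>p. T \<xi> p + T \<eta> p)"
    and "\<xi> \<in> l2 \<Longrightarrow> T (\<lambda>p. c * \<xi> p) = (\<lambda>p. c * T \<xi> p)"
  using assms unfolding bounded_op_def by blast+

lemma bounded_op_l2: "bounded_op T \<Longrightarrow> T \<xi> \<in> l2"
  by (cases "\<xi> \<in> l2") (auto simp: bounded_opD l2_zero)

lemma bounded_op_obtain_bound:
  assumes "bounded_op T"
  obtains K where "0 < K" "\<And>\<xi>. \<xi> \<in> l2 \<Longrightarrow> l2norm (T \<xi>) \<le> K * l2norm \<xi>"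
proof -
  obtain K where K: "\<And>\<xi>. \<xi> \<in> l2 \<Longrightarrow> l2norm (T \<xi>) \<le> K * l2norm \<xi>"
    using assms unfolding bounded_op_def by blast
  have "l2norm (T \<xi>) \<le> max K 1 * l2norm \<xi>" if "\<xi> \<in> l2" for \<xi>
    by (rule order_trans[OF K[OF that]], rule mult_right_mono) (auto simp: l2norm_nonneg)
  then show thesis by (intro that[of "max K 1"]) auto
qed

lemma bounded_opI:
  assumes "\<And>\<xi>. \<xi> \<notin> l2 \<Longrightarrow> T \<xi> = (\<lambda>_. 0)" "\<And>\<xi>. \<xi> \<in> l2 \<Longrightarrow> T \<xi> \<in> l2"
    and "\<And>\<xi> \<eta>. \<xi> \<in> l2 \<Longrightarrow> \<eta> \<in> l2 \<Longrightarrow> T (\<lambda>p. \<xi> p + \<eta> p) = (\<lambda>p. T \<xi> p + T \<eta> p)"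
    and "\<And>\<xi> c. \<xi> \<in> l2 \<Longrightarrow> T (\<lambda>p. c * \<xi> p) = (\<lambda>p. c * T \<xi> p)"
    and "\<And>\<xi>. \<xi> \<in> l2 \<Longrightarrow> l2norm (T \<xi>) \<le> K * l2norm \<xi>"
  shows "bounded_op T"
  unfolding bounded_op_def using assms by blast

lemma bounded_op_zero: "bounded_op (\<lambda>_ _. 0)"
  unfolding bounded_op_def by (auto simp: l2_zero l2norm_zero intro!: exI[of _ 0])

lemma bounded_op_add:
  assumes "bounded_op S" "bounded_op T"
  shows "bounded_op (\<lambda>\<xi> p. S \<xi> p + T \<xi> p)"
proof -
  obtain K L where K: "\<And>\<xi>. \<xi> \<in> l2 \<Longrightarrow> l2norm (S \<xi>) \<le> K * l2norm \<xi>"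
    and L: "\<And>\<xi>. \<xi> \<in> l2 \<Longrightarrow> l2norm (T \<xi>) \<le> L * l2norm \<xi>"
    using assms bounded_op_obtain_bound by metis
  have "l2norm (\<lambda>p. S \<xi> p + T \<xi> p) \<le> (K + L) * l2norm \<xi>" if "\<xi> \<in> l2" for \<xi>
    using l2norm_triangle[OF bounded_op_l2[OF assms(1)] bounded_op_l2[OF assms(2)], of \<xi> \<xi>]
      K[OF that] L[OF that] by (simp add: distrib_right)
  then show ?thesis using assms
    by (intro bounded_opI[of _ "K + L"]) (auto simp: bounded_opD l2_add bounded_op_l2 algebra_simps)
qed

lemma bounded_op_cmult:
  assumes "bounded_op S"
  shows "bounded_op (\<lambda>\<xi> p. c * S \<xi> p)"
proof -
  obtain K where K: "\<And>\<xi>. \<xi> \<in> l2 \<Longrightarrow> l2norm (S \<xi>) \<le> K * l2norm \<xi>"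
    using assms bounded_op_obtain_bound by metis
  have "l2norm (\<lambda>p. c * S \<xi> p) \<le> (cmod c * K) * l2norm \<xi>" if "\<xi> \<in> l2" for \<xi>
    using mult_left_mono[OF K[OF that], of "cmod c"]
    by (simp add: l2norm_cmult bounded_op_l2[OF assms] mult.assoc)
  then show ?thesis using assms
    by (intro bounded_opI[of _ "cmod c * K"]) (auto simp: bounded_opD l2_cmult bounded_op_l2 algebra_simps)
qed

lemma bounded_op_diff:
  assumes "bounded_op S" "bounded_op T"
  shows "bounded_op (op_diff S T)"
  using bounded_op_add[OF assms(1) bounded_op_cmult[OF assms(2), of "-1"]]
  by (simp add: op_diff_def)

lemma bounded_op_comp:
  assumes "bounded_op S" "bounded_op T"
  shows "bounded_op (S \<circ> T)"
proof -
  obtain K where K: "0 < K" "\<And>\<xi>. \<xi> \<in> l2 \<Longrightarrow> l2norm (S \<xi>) \<le> K * l2norm \<xi>"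
    using assms bounded_op_obtain_bound by metis
  obtain L where L: "\<And>\<xi>. \<xi> \<in> l2 \<Longrightarrow> l2norm (T \<xi>) \<le> L * l2norm \<xi>"
    using assms bounded_op_obtain_bound by metis
  have "l2norm (S (T \<xi>)) \<le> (K * L) * l2norm \<xi>" if "\<xi> \<in> l2" for \<xi>
    using order_trans[OF K(2)[OF bounded_op_l2[OF assms(2)], of \<xi>] mult_left_mono[OF L[OF that], of K]] K(1)
    by (simp add: mult.assoc)
  moreover have "S (\<lambda>_. 0) = (\<lambda>_. 0)"
    using bounded_opD(4)[OF assms(1) l2_zero, of 0] by simp
  ultimately show ?thesis using assms
    by (intro bounded_opI[of _ "K * L"]) (auto simp: bounded_opD bounded_op_l2)
qed

lemma bounded_op_sum:
  assumes "finite I" "\<And>i. i \<in> I \<Longrightarrow> bounded_op (T i)"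
  shows "bounded_op (\<lambda>\<xi> p. \<Sum>i\<in>I. T i \<xi> p)"
  using assms by (induction I rule: finite_induct) (auto simp: bounded_op_zero bounded_op_add)

lemma bounded_op_apply_sum:
  assumes "bounded_op T" "finite I" "\<And>i. i \<in> I \<Longrightarrow> \<xi> i \<in> l2"
  shows "T (\<lambda>p. \<Sum>i\<in>I. c i * \<xi> i p) = (\<lambda>p. \<Sum>i\<in>I. c i * T (\<xi> i) p)"
  using assms(2,3)
proof (induction I rule: finite_induct)
  case empty
  then show ?case using bounded_opD(4)[OF assms(1) l2_zero, of 0] by simp
next
  case (insert x I)
  then have "T (\<lambda>p. c x * \<xi> x p + (\<Sum>i\<in>I. c i * \<xi> i p))
      = (\<lambda>p. T (\<lambda>p. c x * \<xi> x p) p + T (\<lambda>p. \<Sum>i\<in>I. c i * \<xi> i p) p)"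
    by (intro bounded_opD(3)[OF assms(1)] l2_cmult l2_sum) auto
  with insert show ?case by (simp add: bounded_opD(4)[OF assms(1)])
qed

lemma bounded_op_apply_diff:
  assumes "bounded_op T" "\<xi> \<in> l2" "\<eta> \<in> l2"
  shows "T (\<lambda>p. \<xi> p - \<eta> p) = (\<lambda>p. T \<xi> p - T \<eta> p)"
  using bounded_opD(3)[OF assms(1,2) l2_cmult[OF assms(3), of "-1"]]
    bounded_opD(4)[OF assms(1,3), of "-1"] by simp

lemma opnorm_le:
  assumes "0 \<le> K" "\<And>\<xi>. \<xi> \<in> l2 \<Longrightarrow> l2norm (T \<xi>) \<le> K * l2norm \<xi>"
  shows "opnorm T \<le> K"
  unfolding opnorm_def
proof (rule cSup_least)
  have "(\<lambda>_. 0) \<in> l2" "l2norm (\<lambda>_. 0) \<le> 1" by (auto simp: l2_zero l2norm_zero)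
  then show "{l2norm (T \<xi>) |\<xi>. \<xi> \<in> l2 \<and> l2norm \<xi> \<le> 1} \<noteq> {}" by blast
  fix y assume "y \<in> {l2norm (T \<xi>) |\<xi>. \<xi> \<in> l2 \<and> l2norm \<xi> \<le> 1}"
  then obtain \<xi> where "y = l2norm (T \<xi>)" "\<xi> \<in> l2" "l2norm \<xi> \<le> 1" by blast
  then show "y \<le> K"
    using order_trans[OF assms(2)[of \<xi>] mult_left_mono[of "l2norm \<xi>" 1 K]] assms(1) by simp
qed

lemma l2norm_le_opnorm:
  assumes "bounded_op T" "\<xi> \<in> l2"
  shows "l2norm (T \<xi>) \<le> opnorm T * l2norm \<xi>"
proof -
  obtain K where K: "0 < K" "\<And>\<xi>. \<xi> \<in> l2 \<Longrightarrow> l2norm (T \<xi>) \<le> K * l2norm \<xi>"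
    using assms(1) bounded_op_obtain_bound by metis
  have bdd: "bdd_above {l2norm (T \<xi>) |\<xi>. \<xi> \<in> l2 \<and> l2norm \<xi> \<le> 1}"
  proof (rule bdd_aboveI[of _ K])
    fix y assume "y \<in> {l2norm (T \<xi>) |\<xi>. \<xi> \<in> l2 \<and> l2norm \<xi> \<le> 1}"
    then obtain \<xi> where "y = l2norm (T \<xi>)" "\<xi> \<in> l2" "l2norm \<xi> \<le> 1" by blast
    then show "y \<le> K"
      using order_trans[OF K(2)[of \<xi>] mult_left_mono[of "l2norm \<xi>" 1 K]] K(1) by simp
  qed
  show ?thesis
  proof (cases "l2norm \<xi> = 0")
    case True
    then show ?thesis using K(2)[OF assms(2)] by simp
  next
    case False
    then have n: "l2norm \<xi> > 0" using l2norm_nonneg[of \<xi>] by simp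
    let ?\<eta> = "\<lambda>p. complex_of_real (1 / l2norm \<xi>) * \<xi> p"
    have "?\<eta> \<in> l2" using assms(2) by (rule l2_cmult)
    moreover have "l2norm ?\<eta> = 1" using n unfolding l2norm_cmult[OF assms(2)] by (simp add: norm_divide)
    ultimately have "l2norm (T ?\<eta>) \<le> opnorm T"
      unfolding opnorm_def by (intro cSup_upper bdd) (auto intro!: exI[of _ ?\<eta>])
    moreover have "l2norm (T ?\<eta>) = l2norm (T \<xi>) / l2norm \<xi>"
      unfolding bounded_opD(4)[OF assms] l2norm_cmult[OF bounded_op_l2[OF assms(1)]] using n by (simp add: norm_divide)
    ultimately have "l2norm (T \<xi>) / l2norm \<xi> \<le> opnorm T" by simp
    then show ?thesis using n by (simp add: pos_divide_le_eq)
  qed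
qed

lemma opnorm_op_diff_lessD:
  assumes "bounded_op S" "bounded_op T" "opnorm (op_diff S T) < \<epsilon>" "\<xi> \<in> l2"
  shows "l2norm (\<lambda>p. S \<xi> p - T \<xi> p) \<le> \<epsilon> * l2norm \<xi>"
proof -
  have "l2norm (op_diff S T \<xi>) \<le> opnorm (op_diff S T) * l2norm \<xi>"
    by (rule l2norm_le_opnorm[OF bounded_op_diff[OF assms(1,2)] assms(4)])
  also have "\<dots> \<le> \<epsilon> * l2norm \<xi>" using assms(3) by (intro mult_right_mono) (auto simp: l2norm_nonneg)
  finally show ?thesis by (simp add: op_diff_def)
qed

text \<open>Half of \<open>\<epsilon>\<close> is demanded because a supremum of values below
  \<open>\<epsilon>\<close> may equal \<open>\<epsilon>\<close>.\<close>

lemma opnorm_op_diff_lessI: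
  assumes "0 < \<epsilon>" "\<And>\<xi>. \<xi> \<in> l2 \<Longrightarrow> l2norm (\<lambda>p. S \<xi> p - T \<xi> p) \<le> \<epsilon> / 2 * l2norm \<xi>"
  shows "opnorm (op_diff S T) < \<epsilon>"
proof -
  have "opnorm (op_diff S T) \<le> \<epsilon> / 2"
    using assms by (intro opnorm_le) (auto simp: op_diff_def)
  then show ?thesis using assms(1) by simp
qed

lemma tendsto_zero_approxI:
  fixes a :: "nat \<Rightarrow> real"
  assumes "\<And>n. 0 \<le> a n"
    and "\<And>\<epsilon>. 0 < \<epsilon> \<Longrightarrow> \<exists>b. (\<forall>n. a n \<le> b n + \<epsilon>) \<and> b \<longlonglongrightarrow> 0"
  shows "a \<longlonglongrightarrow> 0"
proof (rule order_tendstoI)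
  fix e :: real assume "e < 0"
  then have "e < a n" for n using assms(1)[of n] by linarith
  then show "\<forall>\<^sub>F n in sequentially. e < a n" by simp
next
  fix e :: real assume "0 < e"
  then obtain b where b: "\<And>n. a n \<le> b n + e / 2" "b \<longlonglongrightarrow> 0" using assms(2)[of "e / 2"] by auto
  have "\<forall>\<^sub>F n in sequentially. b n < e / 2" using order_tendstoD(2)[OF b(2), of "e / 2"] \<open>0 < e\<close> by simp
  then show "\<forall>\<^sub>F n in sequentially. a n < e"
  proof eventually_elim
    case (elim n)
    then show ?case using b(1)[of n] by linarith
  qed
qed

section \<open>The reduced crossed product\<close>

locale compact_action =
  fixes act :: "'g::group_add \<Rightarrow> 'x::t2_space \<Rightarrow> 'x"
  assumes compact: "compact (UNIV :: 'x set)"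
    and act_zero: "act 0 x = x"
    and act_add: "act (g + h) x = act g (act h x)"
    and continuous_act: "continuous_on A (act g)"
begin

lemma act_uminus [simp]: "act (- g) (act g x) = x" "act g (act (- g) x) = x"
  by (simp_all add: act_add[symmetric] act_zero)

lemma covrep_apply:
  "\<xi> \<in> l2 \<Longrightarrow> covrep act f g \<xi> = (\<lambda>(h, x). f (act h x) * \<xi> (- g + h, x))"
  by (simp add: covrep_def clean_op_def)

lemma bounded_op_covrep:
  assumes "continuous_on UNIV f"
  shows "bounded_op (covrep act f g)"
proof -
  have "bounded (range f)" using compact_continuous_image[OF assms compact] by (rule compact_imp_bounded)
  then obtain K where K: "\<And>x. cmod (f x) \<le> K" by (auto simp: bounded_iff)
  have K0: "0 \<le> K" using norm_ge_zero K order_trans by blast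
  have le: "L2_set (\<lambda>p. cmod (covrep act f g \<xi> p)) A \<le> K * l2norm \<xi>"
    if "\<xi> \<in> l2" "finite A" for \<xi> A
  proof -
    let ?s = "\<lambda>(h, x). (- g + h, x)"
    have "L2_set (\<lambda>p. cmod (covrep act f g \<xi> p)) A \<le> L2_set (\<lambda>p. K * cmod (\<xi> (?s p))) A"
      using K that by (intro L2_set_mono) (auto simp: covrep_apply norm_mult intro!: mult_right_mono)
    also have "\<dots> = K * L2_set (\<lambda>p. cmod (\<xi> (?s p))) A"
      using K0 by (simp add: L2_set_right_distrib)
    also have "L2_set (\<lambda>p. cmod (\<xi> (?s p))) A = L2_set (\<lambda>p. cmod (\<xi> p)) (?s ` A)"
      unfolding L2_set_def by (subst sum.reindex) (auto simp: inj_on_def case_prod_beta)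
    also have "K * \<dots> \<le> K * l2norm \<xi>"
      using that K0 by (intro mult_left_mono L2_set_le_l2norm) auto
    finally show ?thesis .
  qed
  show ?thesis
  proof (rule bounded_opI[of _ K])
    show "covrep act f g \<xi> = (\<lambda>_. 0)" if "\<xi> \<notin> l2" for \<xi>
      using that by (simp add: covrep_def clean_op_def)
    show "covrep act f g \<xi> \<in> l2" "l2norm (covrep act f g \<xi>) \<le> K * l2norm \<xi>" if "\<xi> \<in> l2" for \<xi>
      using l2_I[OF le[OF that]] l2norm_leI[OF le[OF that]] by auto
  qed (auto simp: covrep_apply l2_add l2_cmult fun_eq_iff algebra_simps)
qed

text \<open>Covariance: translation by \<open>g\<close> passes multiplication by \<open>f'\<close>
  at the price of composing \<open>f'\<close> with \<open>act (- g)\<close>. Outside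
  \<open>l2\<close> both sides vanish by the convention of \<open>clean_op\<close>.\<close>

lemma covrep_comp:
  assumes "continuous_on UNIV f'"
  shows "covrep act f g (covrep act f' g' \<xi>) = covrep act (\<lambda>y. f y * f' (act (- g) y)) (g + g') \<xi>"
proof (cases "\<xi> \<in> l2")
  case True
  have "covrep act f g (covrep act f' g' \<xi>) = (\<lambda>(h, x). f (act h x) * covrep act f' g' \<xi> (- g + h, x))"
    by (rule covrep_apply[OF bounded_op_l2[OF bounded_op_covrep[OF assms]]])
  also have "\<dots> = covrep act (\<lambda>y. f y * f' (act (- g) y)) (g + g') \<xi>"
    using True by (simp add: covrep_apply fun_eq_iff act_add minus_add add.assoc[symmetric] mult.assoc)
  finally show ?thesis .
next
  case False
  then show ?thesis using l2_zero by (auto simp: covrep_def clean_op_def fun_eq_iff)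
qed

text \<open>A bijection with an initial segment of the naturals frees the index type, so that sums
  and products of elements can be indexed by disjoint unions and cartesian products.\<close>

lemma crossed_algI:
  fixes I :: "'i set"
  assumes "finite I" "\<And>i. i \<in> I \<Longrightarrow> continuous_on UNIV (F i)"
  shows "(\<lambda>\<xi> p. \<Sum>i\<in>I. covrep act (F i) (g i) \<xi> p) \<in> crossed_alg act"
proof -
  obtain b where b: "bij_betw b {0..<card I} I" using ex_bij_betw_nat_finite[OF assms(1)] by blast
  have "(\<lambda>\<xi> p. \<Sum>i\<in>I. covrep act (F i) (g i) \<xi> p)
      = (\<lambda>\<xi> p. \<Sum>i\<in>{0..<card I}. covrep act (F (b i)) (g (b i)) \<xi> p)"
    using sum.reindex_bij_betw[OF b] by (intro ext) (rule sum.reindex_bij_betw[OF b, symmetric])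
  moreover have "\<forall>i\<in>{0..<card I}. continuous_on UNIV (F (b i))"
    using assms(2) b by (auto simp: bij_betw_def)
  ultimately show ?thesis unfolding crossed_alg_def
    by (intro CollectI exI[of _ "{0..<card I}"] exI[of _ "\<lambda>i. F (b i)"] exI[of _ "\<lambda>i. g (b i)"]) simp
qed

lemma crossed_algE:
  assumes "S \<in> crossed_alg act"
  obtains I :: "nat set" and F g where "finite I" "\<forall>i\<in>I. continuous_on UNIV (F i)"
    "S = (\<lambda>\<xi> p. \<Sum>i\<in>I. covrep act (F i) (g i) \<xi> p)"
  using assms unfolding crossed_alg_def by blast

lemma bounded_op_crossed_alg: "S \<in> crossed_alg act \<Longrightarrow> bounded_op S"
  by (erule crossed_algE, hypsubst, rule bounded_op_sum) (auto intro: bounded_op_covrep)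

lemma covrep_in_crossed_alg: "continuous_on UNIV f \<Longrightarrow> covrep act f g \<in> crossed_alg act"
  using crossed_algI[of "{()}" "\<lambda>_. f" "\<lambda>_. g"] by simp

lemma crossed_alg_add:
  assumes "S \<in> crossed_alg act" "T \<in> crossed_alg act"
  shows "(\<lambda>\<xi> p. S \<xi> p + T \<xi> p) \<in> crossed_alg act"
proof -
  obtain I F g where 1: "finite (I :: nat set)" "\<forall>i\<in>I. continuous_on UNIV (F i)"
    "S = (\<lambda>\<xi> p. \<Sum>i\<in>I. covrep act (F i) (g i) \<xi> p)" by (rule crossed_algE[OF assms(1)])
  obtain J F' g' where 2: "finite (J :: nat set)" "\<forall>i\<in>J. continuous_on UNIV (F' i)"
    "T = (\<lambda>\<xi> p. \<Sum>i\<in>J. covrep act (F' i) (g' i) \<xi> p)" by (rule crossed_algE[OF assms(2)])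
  have "(\<lambda>\<xi> p. \<Sum>i\<in>I <+> J. covrep act (case_sum F F' i) (case_sum g g' i) \<xi> p) \<in> crossed_alg act"
    using 1 2 by (intro crossed_algI) auto
  then show ?thesis using 1 2 by (simp add: sum.Plus)
qed

lemma crossed_alg_comp:
  assumes "S \<in> crossed_alg act" "T \<in> crossed_alg act"
  shows "S \<circ> T \<in> crossed_alg act"
proof -
  obtain I F g where 1: "finite (I :: nat set)" "\<forall>i\<in>I. continuous_on UNIV (F i)"
    "S = (\<lambda>\<xi> p. \<Sum>i\<in>I. covrep act (F i) (g i) \<xi> p)" by (rule crossed_algE[OF assms(1)])
  obtain J F' g' where 2: "finite (J :: nat set)" "\<forall>i\<in>J. continuous_on UNIV (F' i)"
    "T = (\<lambda>\<xi> p. \<Sum>i\<in>J. covrep act (F' i) (g' i) \<xi> p)" by (rule crossed_algE[OF assms(2)])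
  have "(S \<circ> T) \<xi> p = (\<Sum>k\<in>I \<times> J. covrep act (\<lambda>y. F (fst k) y * F' (snd k) (act (- g (fst k)) y))
       (g (fst k) + g' (snd k)) \<xi> p)" for \<xi> p
  proof -
    have "covrep act (F i) (g i) (\<lambda>p. \<Sum>j\<in>J. 1 * covrep act (F' j) (g' j) \<xi> p) p
        = (\<Sum>j\<in>J. 1 * covrep act (F i) (g i) (covrep act (F' j) (g' j) \<xi>) p)" if "i \<in> I" for i
      using bounded_op_apply_sum[OF bounded_op_covrep[OF 1(2)[rule_format, OF that]] 2(1),
          of "\<lambda>j. covrep act (F' j) (g' j) \<xi>" "g i" "\<lambda>_. 1"] 2(2)
        bounded_op_l2[OF bounded_op_covrep] by simp
    then show ?thesis using 1(3) 2(2,3)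
      by (simp add: covrep_comp sum.cartesian_product case_prod_beta)
  qed
  then have "S \<circ> T = (\<lambda>\<xi> p. \<Sum>k\<in>I \<times> J. covrep act (\<lambda>y. F (fst k) y * F' (snd k) (act (- g (fst k)) y))
       (g (fst k) + g' (snd k)) \<xi> p)" by (simp add: fun_eq_iff)
  also have "\<dots> \<in> crossed_alg act"
  proof (rule crossed_algI)
    fix k assume k: "k \<in> I \<times> J"
    show "continuous_on UNIV (\<lambda>y. F (fst k) y * F' (snd k) (act (- g (fst k)) y))"
    proof (rule continuous_on_mult)
      show "continuous_on UNIV (F (fst k))" using k 1(2) by auto
      have "continuous_on UNIV (F' (snd k))" using k 2(2) by auto
      then show "continuous_on UNIV (\<lambda>y. F' (snd k) (act (- g (fst k)) y))"
        by (rule continuous_on_compose2[OF _ continuous_act subset_UNIV])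
    qed
  qed (use 1 2 in auto)
  finally show ?thesis .
qed

section \<open>The norm closure is an algebra\<close>

abbreviation "red \<equiv> reduced_crossed_product act"

lemma bounded_op_red: "T \<in> red \<Longrightarrow> bounded_op T"
  by (simp add: reduced_crossed_product_def)

lemma red_approx:
  assumes "T \<in> red" "0 < \<epsilon>"
  obtains S where "S \<in> crossed_alg act" "\<And>\<xi>. \<xi> \<in> l2 \<Longrightarrow> l2norm (\<lambda>p. T \<xi> p - S \<xi> p) \<le> \<epsilon> * l2norm \<xi>"
proof -
  obtain S where S: "S \<in> crossed_alg act" "opnorm (op_diff T S) < \<epsilon>"
    using assms unfolding reduced_crossed_product_def by blast
  then show thesis
    using opnorm_op_diff_lessD[OF bounded_op_red[OF assms(1)] bounded_op_crossed_alg] by (intro that[of S]) auto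
qed

lemma redI:
  assumes "bounded_op T"
    and "\<And>\<epsilon>. 0 < \<epsilon> \<Longrightarrow> \<exists>S\<in>crossed_alg act. \<forall>\<xi>\<in>l2. l2norm (\<lambda>p. T \<xi> p - S \<xi> p) \<le> \<epsilon> * l2norm \<xi>"
  shows "T \<in> red"
  unfolding reduced_crossed_product_def
proof (intro CollectI conjI allI impI assms(1))
  fix \<epsilon> :: real assume "0 < \<epsilon>"
  then obtain S where "S \<in> crossed_alg act" "\<forall>\<xi>\<in>l2. l2norm (\<lambda>p. T \<xi> p - S \<xi> p) \<le> \<epsilon> / 2 * l2norm \<xi>"
    using assms(2)[of "\<epsilon> / 2"] by auto
  then show "\<exists>S\<in>crossed_alg act. opnorm (op_diff T S) < \<epsilon>"
    using opnorm_op_diff_lessI[OF \<open>0 < \<epsilon>\<close>, of T S] by blast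
qed

lemma crossed_alg_subset_red: "crossed_alg act \<subseteq> red"
proof
  fix T assume T: "T \<in> crossed_alg act"
  show "T \<in> red"
  proof (rule redI)
    show "\<exists>S\<in>crossed_alg act. \<forall>\<xi>\<in>l2. l2norm (\<lambda>p. T \<xi> p - S \<xi> p) \<le> \<epsilon> * l2norm \<xi>" if "0 < \<epsilon>" for \<epsilon>
      using that T by (intro bexI[of _ T]) (auto simp: l2norm_zero l2norm_nonneg)
  qed (rule bounded_op_crossed_alg[OF T])
qed

lemma red_add:
  assumes "S \<in> red" "T \<in> red"
  shows "(\<lambda>\<xi> p. S \<xi> p + T \<xi> p) \<in> red"
proof (rule redI)
  have bS: "bounded_op S" and bT: "bounded_op T" using assms bounded_op_red by auto
  show "bounded_op (\<lambda>\<xi> p. S \<xi> p + T \<xi> p)" by (rule bounded_op_add[OF bS bT])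
  fix \<epsilon> :: real assume "0 < \<epsilon>"
  then have e: "0 < \<epsilon> / 2" by simp
  obtain S' where S': "S' \<in> crossed_alg act" "\<And>\<xi>. \<xi> \<in> l2 \<Longrightarrow> l2norm (\<lambda>p. S \<xi> p - S' \<xi> p) \<le> \<epsilon> / 2 * l2norm \<xi>"
    using red_approx[OF assms(1) e] by blast
  obtain T' where T': "T' \<in> crossed_alg act" "\<And>\<xi>. \<xi> \<in> l2 \<Longrightarrow> l2norm (\<lambda>p. T \<xi> p - T' \<xi> p) \<le> \<epsilon> / 2 * l2norm \<xi>"
    using red_approx[OF assms(2) e] by blast
  show "\<exists>R\<in>crossed_alg act. \<forall>\<xi>\<in>l2. l2norm (\<lambda>p. S \<xi> p + T \<xi> p - R \<xi> p) \<le> \<epsilon> * l2norm \<xi>"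
  proof (intro bexI[of _ "\<lambda>\<xi> p. S' \<xi> p + T' \<xi> p"] ballI)
    fix \<xi> :: "'g \<times> 'x \<Rightarrow> complex" assume \<xi>: "\<xi> \<in> l2"
    have l2: "(\<lambda>p. S \<xi> p - S' \<xi> p) \<in> l2" "(\<lambda>p. T \<xi> p - T' \<xi> p) \<in> l2"
      by (intro l2_diff bounded_op_l2[OF bS] bounded_op_l2[OF bT]
          bounded_op_l2[OF bounded_op_crossed_alg[OF S'(1)]]
          bounded_op_l2[OF bounded_op_crossed_alg[OF T'(1)]])+
    have "l2norm (\<lambda>p. S \<xi> p + T \<xi> p - (S' \<xi> p + T' \<xi> p))
        = l2norm (\<lambda>p. (S \<xi> p - S' \<xi> p) + (T \<xi> p - T' \<xi> p))" by (simp add: algebra_simps)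
    also have "\<dots> \<le> \<epsilon> / 2 * l2norm \<xi> + \<epsilon> / 2 * l2norm \<xi>"
      using l2norm_triangle[OF l2] S'(2)[OF \<xi>] T'(2)[OF \<xi>] by linarith
    finally show "l2norm (\<lambda>p. S \<xi> p + T \<xi> p - (S' \<xi> p + T' \<xi> p)) \<le> \<epsilon> * l2norm \<xi>" by simp
  qed (rule crossed_alg_add[OF S'(1) T'(1)])
qed

lemma red_comp:
  assumes "S \<in> red" "T \<in> red"
  shows "S \<circ> T \<in> red"
proof (rule redI)
  have bS: "bounded_op S" and bT: "bounded_op T" using assms bounded_op_red by auto
  show "bounded_op (S \<circ> T)" by (rule bounded_op_comp[OF bS bT])
  fix \<epsilon> :: real assume \<epsilon>: "0 < \<epsilon>"
  obtain K where K: "0 < K" "\<And>\<xi>. \<xi> \<in> l2 \<Longrightarrow> l2norm (S \<xi>) \<le> K * l2norm \<xi>"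
    using bounded_op_obtain_bound[OF bS] by blast
  \<comment> \<open>\<open>T'\<close> is chosen before \<open>S'\<close>, because the tolerance for
    \<open>S'\<close> is scaled by a bound \<open>L\<close> of \<open>T'\<close>.\<close>
  have "0 < \<epsilon> / 2 / K" using \<epsilon> K by simp
  then obtain T' where T': "T' \<in> crossed_alg act"
      "\<And>\<xi>. \<xi> \<in> l2 \<Longrightarrow> l2norm (\<lambda>p. T \<xi> p - T' \<xi> p) \<le> \<epsilon> / 2 / K * l2norm \<xi>"
    using red_approx[OF assms(2)] by blast
  have bT': "bounded_op T'" by (rule bounded_op_crossed_alg[OF T'(1)])
  obtain L where L: "0 < L" "\<And>\<xi>. \<xi> \<in> l2 \<Longrightarrow> l2norm (T' \<xi>) \<le> L * l2norm \<xi>"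
    using bounded_op_obtain_bound[OF bT'] by blast
  have "0 < \<epsilon> / 2 / L" using \<epsilon> L by simp
  then obtain S' where S': "S' \<in> crossed_alg act"
      "\<And>\<xi>. \<xi> \<in> l2 \<Longrightarrow> l2norm (\<lambda>p. S \<xi> p - S' \<xi> p) \<le> \<epsilon> / 2 / L * l2norm \<xi>"
    using red_approx[OF assms(1)] by blast
  have bS': "bounded_op S'" by (rule bounded_op_crossed_alg[OF S'(1)])
  show "\<exists>R\<in>crossed_alg act. \<forall>\<xi>\<in>l2. l2norm (\<lambda>p. (S \<circ> T) \<xi> p - R \<xi> p) \<le> \<epsilon> * l2norm \<xi>"
  proof (intro bexI[of _ "S' \<circ> T'"] ballI)
    fix \<xi> :: "'g \<times> 'x \<Rightarrow> complex" assume \<xi>: "\<xi> \<in> l2"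
    have l2: "T \<xi> \<in> l2" "T' \<xi> \<in> l2" using bT bT' by (auto intro: bounded_op_l2)
    have d: "(\<lambda>p. S (T \<xi>) p - S (T' \<xi>) p) \<in> l2" "(\<lambda>p. S (T' \<xi>) p - S' (T' \<xi>) p) \<in> l2"
      by (intro l2_diff bounded_op_l2[OF bS] bounded_op_l2[OF bS'])+
    have "l2norm (\<lambda>p. S (T \<xi>) p - S (T' \<xi>) p) \<le> K * l2norm (\<lambda>p. T \<xi> p - T' \<xi> p)"
      using K(2)[OF l2_diff[OF l2]] by (simp add: bounded_op_apply_diff[OF bS l2])
    also have "\<dots> \<le> K * (\<epsilon> / 2 / K * l2norm \<xi>)" using T'(2)[OF \<xi>] K(1) by (intro mult_left_mono) auto
    also have "\<dots> = \<epsilon> / 2 * l2norm \<xi>" using K(1) by simp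
    finally have 1: "l2norm (\<lambda>p. S (T \<xi>) p - S (T' \<xi>) p) \<le> \<epsilon> / 2 * l2norm \<xi>" .
    have "l2norm (\<lambda>p. S (T' \<xi>) p - S' (T' \<xi>) p) \<le> \<epsilon> / 2 / L * l2norm (T' \<xi>)" by (rule S'(2)[OF l2(2)])
    also have "\<dots> \<le> \<epsilon> / 2 / L * (L * l2norm \<xi>)" using L(2)[OF \<xi>] L(1) \<epsilon> by (intro mult_left_mono) auto
    also have "\<dots> = \<epsilon> / 2 * l2norm \<xi>" using L(1) by simp
    finally have 2: "l2norm (\<lambda>p. S (T' \<xi>) p - S' (T' \<xi>) p) \<le> \<epsilon> / 2 * l2norm \<xi>" .
    show "l2norm (\<lambda>p. (S \<circ> T) \<xi> p - (S' \<circ> T') \<xi> p) \<le> \<epsilon> * l2norm \<xi>"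
      using l2norm_triangle[OF d] 1 2 by simp
  qed (rule crossed_alg_comp[OF S'(1) T'(1)])
qed

text \<open>Scalars are constant functions in the algebra, so closure under scalar multiples follows
  from closure under composition.\<close>

lemma const_comp:
  assumes "bounded_op S"
  shows "covrep act (\<lambda>_. c) 0 \<circ> S = (\<lambda>\<xi> p. c * S \<xi> p)"
  by (auto simp: fun_eq_iff covrep_apply bounded_op_l2[OF assms])

lemma red_cmult:
  assumes "S \<in> red"
  shows "(\<lambda>\<xi> p. c * S \<xi> p) \<in> red"
proof -
  have "covrep act (\<lambda>_. c) 0 \<in> red"
    using covrep_in_crossed_alg[of "\<lambda>_. c" 0] crossed_alg_subset_red by auto
  from red_comp[OF this assms] show ?thesis by (simp add: const_comp bounded_op_red[OF assms])
qed

lemma red_zero: "(\<lambda>_ _. 0) \<in> red"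
  using crossed_algI[of "{}::nat set"] crossed_alg_subset_red by auto

text \<open>Left multiplication and norm limits need only bounds on the operators and vectors. Right
  multiplication rests on \<open>perm\<close>: a generator turns each sequence of vectors into a
  multiple of another one of the family.\<close>

lemma closed_ideal_vanishing:
  fixes v :: "'s \<Rightarrow> nat \<Rightarrow> ('g \<times> 'x \<Rightarrow> complex)"
  assumes v: "\<And>s n. v s n \<in> l2" "\<And>s n. l2norm (v s n) \<le> 1"
    and perm: "\<And>f g s. \<exists>c s'. \<forall>n. covrep act f g (v s n) = (\<lambda>p. c * v s' n p)"
  shows "closed_ideal red {T \<in> red. \<forall>s. (\<lambda>n. l2norm (T (v s n))) \<longlonglongrightarrow> 0}"
    (is "closed_ideal red ?I")
  unfolding closed_ideal_def
proof (intro conjI ballI allI impI)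
  show "?I \<subseteq> red" by blast
  show "(\<lambda>_ _. 0) \<in> ?I" by (simp add: red_zero l2norm_zero)
next
  fix S T assume S: "S \<in> ?I" and T: "T \<in> ?I"
  have "(\<lambda>n. l2norm (\<lambda>p. S (v s n) p + T (v s n) p)) \<longlonglongrightarrow> 0" for s
  proof (rule tendsto_sandwich[of "\<lambda>_. 0", OF _ _ tendsto_const])
    show "(\<lambda>n. l2norm (S (v s n)) + l2norm (T (v s n))) \<longlonglongrightarrow> 0"
      using S T tendsto_add[of "\<lambda>n. l2norm (S (v s n))" 0 sequentially "\<lambda>n. l2norm (T (v s n))" 0] by simp
    show "\<forall>\<^sub>F n in sequentially. l2norm (\<lambda>p. S (v s n) p + T (v s n) p) \<le> l2norm (S (v s n)) + l2norm (T (v s n))"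
      using S T by (intro always_eventually allI l2norm_triangle bounded_op_l2 bounded_op_red) auto
  qed (simp add: l2norm_nonneg)
  then show "(\<lambda>\<xi> p. S \<xi> p + T \<xi> p) \<in> ?I" using S T by (auto intro: red_add)
next
  fix S c assume S: "S \<in> ?I"
  then have "l2norm (\<lambda>p. c * S (v s n) p) = cmod c * l2norm (S (v s n))" for s n
    by (intro l2norm_cmult bounded_op_l2 bounded_op_red) auto
  then show "(\<lambda>\<xi> p. c * S \<xi> p) \<in> ?I" using S by (auto intro!: red_cmult tendsto_mult_right_zero)
next
  fix S a assume S: "S \<in> ?I" and a: "a \<in> red"
  obtain K where K: "0 < K" "\<And>\<xi>. \<xi> \<in> l2 \<Longrightarrow> l2norm (a \<xi>) \<le> K * l2norm \<xi>"
    using bounded_op_obtain_bound[OF bounded_op_red[OF a]] by blast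
  have "(\<lambda>n. l2norm (a (S (v s n)))) \<longlonglongrightarrow> 0" for s
  proof (rule tendsto_sandwich[of "\<lambda>_. 0", OF _ _ tendsto_const])
    show "(\<lambda>n. K * l2norm (S (v s n))) \<longlonglongrightarrow> 0" using S by (auto intro!: tendsto_mult_right_zero)
    show "\<forall>\<^sub>F n in sequentially. l2norm (a (S (v s n))) \<le> K * l2norm (S (v s n))"
      using S by (intro always_eventually allI K bounded_op_l2 bounded_op_red) auto
  qed (simp add: l2norm_nonneg)
  then show "a \<circ> S \<in> ?I" using S a by (auto intro!: red_comp)
next
  fix S a assume S: "S \<in> ?I" and a: "a \<in> red"
  have bS: "bounded_op S" using S bounded_op_red by blast
  have ba: "bounded_op a" using a bounded_op_red by blast
  obtain K where K: "0 < K" "\<And>\<xi>. \<xi> \<in> l2 \<Longrightarrow> l2norm (S \<xi>) \<le> K * l2norm \<xi>"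
    using bounded_op_obtain_bound[OF bS] by blast
  have alg: "(\<lambda>n. l2norm (S (b (v s n)))) \<longlonglongrightarrow> 0" if b_in: "b \<in> crossed_alg act" for b s
  proof -
    obtain I F g where b: "finite (I :: nat set)" "b = (\<lambda>\<xi> p. \<Sum>i\<in>I. covrep act (F i) (g i) \<xi> p)"
      by (rule crossed_algE[OF b_in]) (rule that)
    \<comment> \<open>Neither the scalar nor the new index depends on \<open>n\<close>, so for fixed
      \<open>b\<close> finitely many null sequences are added.\<close>
    have "\<forall>i. \<exists>c s'. \<forall>n. covrep act (F i) (g i) (v s n) = (\<lambda>p. c * v s' n p)" using perm by blast
    then obtain c s' where cs: "\<And>i n. covrep act (F i) (g i) (v s n) = (\<lambda>p. c i * v (s' i) n p)" by metis
    have eq: "S (b (v s n)) = (\<lambda>p. \<Sum>i\<in>I. c i * S (v (s' i) n) p)" for n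
      unfolding b cs by (rule bounded_op_apply_sum[OF bS b(1) v(1)])
    show ?thesis
    proof (rule tendsto_sandwich[of "\<lambda>_. 0", OF _ _ tendsto_const])
      show "(\<lambda>n. \<Sum>i\<in>I. cmod (c i) * l2norm (S (v (s' i) n))) \<longlonglongrightarrow> 0"
        using S by (auto intro!: tendsto_null_sum tendsto_mult_right_zero)
      have "l2norm (S (b (v s n))) \<le> (\<Sum>i\<in>I. cmod (c i) * l2norm (S (v (s' i) n)))" for n
        using l2norm_sum[OF b(1), of "\<lambda>i p. c i * S (v (s' i) n) p"]
        by (simp add: eq l2_cmult l2norm_cmult bounded_op_l2[OF bS])
      then show "\<forall>\<^sub>F n in sequentially. l2norm (S (b (v s n))) \<le> (\<Sum>i\<in>I. cmod (c i) * l2norm (S (v (s' i) n)))"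
        by simp
    qed (simp add: l2norm_nonneg)
  qed
  have "(\<lambda>n. l2norm (S (a (v s n)))) \<longlonglongrightarrow> 0" for s
  proof (rule tendsto_zero_approxI)
    fix \<epsilon> :: real assume \<epsilon>: "0 < \<epsilon>"
    then have "0 < \<epsilon> / K" using K by simp
    then obtain b where b: "b \<in> crossed_alg act" "\<And>\<xi>. \<xi> \<in> l2 \<Longrightarrow> l2norm (\<lambda>p. a \<xi> p - b \<xi> p) \<le> \<epsilon> / K * l2norm \<xi>"
      using red_approx[OF a] by blast
    have bb: "bounded_op b" by (rule bounded_op_crossed_alg[OF b(1)])
    have "l2norm (S (a (v s n))) \<le> l2norm (S (b (v s n))) + \<epsilon>" for n
    proof -
      have l2: "a (v s n) \<in> l2" "b (v s n) \<in> l2" using ba bb by (auto intro: bounded_op_l2)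
      have "l2norm (\<lambda>p. S (a (v s n)) p - S (b (v s n)) p) \<le> K * l2norm (\<lambda>p. a (v s n) p - b (v s n) p)"
        using K(2)[OF l2_diff[OF l2]] by (simp add: bounded_op_apply_diff[OF bS l2])
      also have "\<dots> \<le> K * (\<epsilon> / K * l2norm (v s n))" using b(2)[OF v(1)] K(1) by (intro mult_left_mono) auto
      also have "\<dots> \<le> \<epsilon>" using K(1) \<epsilon> v(2)[of s n] by simp
      finally show ?thesis
        using l2norm_triangle_sub[OF bounded_op_l2[OF bS] bounded_op_l2[OF bS], of "a (v s n)" "b (v s n)"] by linarith
    qed
    then show "\<exists>c. (\<forall>n. l2norm (S (a (v s n))) \<le> c n + \<epsilon>) \<and> c \<longlonglongrightarrow> 0"
      using alg[OF b(1)] by (intro exI[of _ "\<lambda>n. l2norm (S (b (v s n)))"]) auto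
  qed (rule l2norm_nonneg)
  then show "S \<circ> a \<in> ?I" using S a by (auto intro!: red_comp)
next
  fix T assume T: "T \<in> red" and approx: "\<forall>\<epsilon>>0. \<exists>S\<in>?I. opnorm (op_diff T S) < \<epsilon>"
  have "(\<lambda>n. l2norm (T (v s n))) \<longlonglongrightarrow> 0" for s
  proof (rule tendsto_zero_approxI)
    fix \<epsilon> :: real assume \<epsilon>: "0 < \<epsilon>"
    then obtain S where S: "S \<in> ?I" "opnorm (op_diff T S) < \<epsilon>" using approx by blast
    have b: "bounded_op T" "bounded_op S" using T S bounded_op_red by auto
    have "l2norm (T (v s n)) \<le> l2norm (S (v s n)) + \<epsilon>" for n
    proof -
      have "l2norm (\<lambda>p. T (v s n) p - S (v s n) p) \<le> \<epsilon> * l2norm (v s n)"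
        by (rule opnorm_op_diff_lessD[OF b S(2) v(1)])
      also have "\<dots> \<le> \<epsilon>" using \<epsilon> v(2)[of s n] by simp
      finally show ?thesis
        using l2norm_triangle_sub[OF bounded_op_l2[OF b(1)] bounded_op_l2[OF b(2)], of "v s n" "v s n"] by linarith
    qed
    then show "\<exists>b. (\<forall>n. l2norm (T (v s n)) \<le> b n + \<epsilon>) \<and> b \<longlonglongrightarrow> 0"
      using S(1) by (intro exI[of _ "\<lambda>n. l2norm (S (v s n))"]) auto
  qed (rule l2norm_nonneg)
  then show "T \<in> ?I" using T by blast
qed

end

section \<open>Almost invariant vectors over a point and the resulting ideal\<close>

lemma sqrt_diff_square_le:
  assumes "0 \<le> a" "0 \<le> b"
  shows "(sqrt a - sqrt b)\<^sup>2 \<le> \<bar>a - b\<bar>"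
proof -
  have "(sqrt a - sqrt b)\<^sup>2 = \<bar>sqrt a - sqrt b\<bar> * \<bar>sqrt a - sqrt b\<bar>"
    by (simp add: power2_eq_square)
  also have "\<dots> \<le> \<bar>sqrt a - sqrt b\<bar> * \<bar>sqrt a + sqrt b\<bar>"
    using assms by (intro mult_left_mono) (auto simp: abs_le_iff)
  also have "\<dots> = \<bar>(sqrt a - sqrt b) * (sqrt a + sqrt b)\<bar>" by (rule abs_mult[symmetric])
  also have "(sqrt a - sqrt b) * (sqrt a + sqrt b) = a - b" using assms by (simp add: algebra_simps)
  finally show ?thesis .
qed

text \<open>The vector is the square root of the density; \<open>sqrt_diff_square_le\<close>
  converts the l1 estimate into an l2 estimate.\<close>

lemma almost_inv_vector:
  fixes H F :: "'g::group_add set"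
  assumes "m \<in> fin_means H" "almost_inv m F \<epsilon>"
  obtains \<xi> where "\<And>h. \<xi> h \<noteq> 0 \<Longrightarrow> h \<in> H" "finite {h. \<xi> h \<noteq> 0}" "sq_sum \<xi> = 1"
    "\<And>f. f \<in> F \<Longrightarrow> sq_sum (\<lambda>h. \<xi> (- f + h) - \<xi> h) \<le> \<epsilon>"
proof -
  obtain A p where A: "finite A" "A \<subseteq> H" "\<forall>h\<in>A. 0 \<le> p h" "sum p A = 1"
      "m = (\<lambda>\<phi>. \<Sum>h\<in>A. p h * \<phi> h)"
    using assms(1) unfolding fin_means_def by auto
  define q where "q = (\<lambda>h. if h \<in> A then p h else 0)"
  have q: "0 \<le> q h" "h \<notin> A \<Longrightarrow> q h = 0" for h using A by (auto simp: q_def)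
  have m: "m \<phi> = (\<Sum>h\<in>A. q h * \<phi> h)" for \<phi> by (simp add: A(5) q_def)
  define \<xi> where "\<xi> = (\<lambda>h. sqrt (q h))"
  have supp: "h \<in> A" if "\<xi> h \<noteq> 0" for h using that q(2)[of h] by (auto simp: \<xi>_def)
  show thesis
  proof (rule that[of \<xi>])
    show "h \<in> H" if "\<xi> h \<noteq> 0" for h using supp[OF that] A by auto
    show "finite {h. \<xi> h \<noteq> 0}" using supp A by (auto intro: finite_subset)
    have "sq_sum \<xi> = (\<Sum>h\<in>A. (\<xi> h)\<^sup>2)" by (rule sq_sum_eq[OF A(1) supp])
    also have "\<dots> = sum p A" using A(3) by (intro sum.cong) (auto simp: \<xi>_def q_def)
    finally show "sq_sum \<xi> = 1" using A by simp
  next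
    fix f assume f: "f \<in> F"
    define B where "B = A \<union> (+) f ` A"
    have B: "finite B" using A by (simp add: B_def)
    have out: "q (- f + h) = 0" if "h \<notin> (+) f ` A" for h
      using that image_eqI[of h "(+) f" "- f + h" A] q(2) by auto
    \<comment> \<open>The sign pattern at which the almost invariance estimate becomes the full l1
      distance between \<open>q\<close> and its translate.\<close>
    define \<phi> where "\<phi> = (\<lambda>h. sgn (q (- f + h) - q h))"
    have "sq_sum (\<lambda>h. \<xi> (- f + h) - \<xi> h) = (\<Sum>h\<in>B. (\<xi> (- f + h) - \<xi> h)\<^sup>2)"
    proof (rule sq_sum_eq[OF B])
      show "h \<in> B" if "\<xi> (- f + h) - \<xi> h \<noteq> 0" for h
        using that out[of h] supp[of h] by (auto simp: B_def \<xi>_def)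
    qed
    also have "\<dots> \<le> (\<Sum>h\<in>B. \<bar>q (- f + h) - q h\<bar>)"
      unfolding \<xi>_def by (intro sum_mono sqrt_diff_square_le q)
    also have "\<dots> = (\<Sum>h\<in>B. q (- f + h) * \<phi> h) - (\<Sum>h\<in>B. q h * \<phi> h)"
      by (simp add: sum_subtractf[symmetric] left_diff_distrib[symmetric] \<phi>_def abs_sgn)
    also have "(\<Sum>h\<in>B. q (- f + h) * \<phi> h) = (\<Sum>h\<in>(+) f ` A. q (- f + h) * \<phi> h)"
      using out by (intro sum.mono_neutral_right B) (auto simp: B_def)
    also have "\<dots> = m (\<lambda>h. \<phi> (f + h))"
      unfolding m by (subst sum.reindex) (auto simp: inj_on_def)
    also have "(\<Sum>h\<in>B. q h * \<phi> h) = m \<phi>"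
      unfolding m using q by (intro sum.mono_neutral_right B) (auto simp: B_def)
    also have "m (\<lambda>h. \<phi> (f + h)) - m \<phi> \<le> \<epsilon>"
    proof -
      have "\<forall>h. \<bar>\<phi> h\<bar> \<le> 1" by (simp add: \<phi>_def abs_sgn_eq)
      then show ?thesis using assms(2) f unfolding almost_inv_def by (meson abs_le_D1)
    qed
    finally show "sq_sum (\<lambda>h. \<xi> (- f + h) - \<xi> h) \<le> \<epsilon>" .
  qed
qed

definition fibre_vec :: "'x \<Rightarrow> ('g \<Rightarrow> real) \<Rightarrow> 'g \<times> 'x \<Rightarrow> complex" where
  "fibre_vec x \<xi> = (\<lambda>(h, y). if y = x then complex_of_real (\<xi> h) else 0)"

lemma
  assumes "finite {h. \<xi> h \<noteq> 0}"
  shows fibre_vec_l2: "fibre_vec x \<xi> \<in> l2"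
    and l2norm_fibre_vec: "l2norm (fibre_vec x \<xi>) = sqrt (sq_sum \<xi>)"
proof -
  let ?A = "(\<lambda>h. (h, x)) ` {h. \<xi> h \<noteq> 0}"
  have fin: "finite ?A" using assms by simp
  have zero: "(cmod (fibre_vec x \<xi> p))\<^sup>2 = 0" if "p \<notin> ?A" for p
    using that by (auto simp: fibre_vec_def split: prod.splits)
  have "(\<lambda>p. (cmod (fibre_vec x \<xi> p))\<^sup>2) summable_on UNIV \<longleftrightarrow> (\<lambda>p. (cmod (fibre_vec x \<xi> p))\<^sup>2) summable_on ?A"
    by (rule summable_on_cong_neutral) (use zero in auto)
  then show "fibre_vec x \<xi> \<in> l2" using fin by (simp add: l2_def)
  have "(\<Sum>\<^sub>\<infinity>p. (cmod (fibre_vec x \<xi> p))\<^sup>2) = (\<Sum>\<^sub>\<infinity>p\<in>?A. (cmod (fibre_vec x \<xi> p))\<^sup>2)"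
    by (rule infsum_cong_neutral) (use zero in auto)
  also have "\<dots> = (\<Sum>p\<in>?A. (cmod (fibre_vec x \<xi> p))\<^sup>2)" using fin by simp
  also have "\<dots> = sq_sum \<xi>"
    unfolding sq_sum_def by (subst sum.reindex) (auto simp: inj_on_def fibre_vec_def)
  finally show "l2norm (fibre_vec x \<xi>) = sqrt (sq_sum \<xi>)" by (simp add: l2norm_def)
qed

lemma Hausdorff_space_euclidean_t2: "Hausdorff_space (euclidean :: 'x::t2_space topology)"
  unfolding Hausdorff_space_def using hausdorff by (simp add: disjnt_def) blast

lemma ex_bump_function:
  fixes z :: "'x::t2_space"
  assumes "compact (UNIV :: 'x set)" "open U" "z \<in> U"
  obtains f :: "'x \<Rightarrow> complex" where "continuous_on UNIV f" "f z = 1" "\<And>y. y \<notin> U \<Longrightarrow> f y = 0"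
proof -
  have "normal_space (euclidean :: 'x topology)"
    using assms(1) by (intro compact_Hausdorff_or_regular_imp_normal_space) (auto simp: compact_space_def Hausdorff_space_euclidean_t2)
  moreover have "closedin euclidean (- U)" "closedin euclidean {z}" "disjnt (- U) {z}"
    using assms by (auto simp: closed_Compl disjnt_def)
  ultimately obtain f where f: "continuous_map euclidean (top_of_set {0..1::real}) f"
      "f ` (- U) \<subseteq> {0}" "f ` {z} \<subseteq> {1}"
    using Urysohn_lemma[of euclidean "- U" "{z}" 0 1] by auto
  have "continuous_on UNIV f" using f(1) by (simp add: continuous_map_in_subtopology)
  then have "continuous_on UNIV (\<lambda>y. complex_of_real (f y))" by (intro continuous_intros)
  then show thesis using f by (intro that[of "\<lambda>y. complex_of_real (f y)"]) auto
qed

context compact_action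
begin

text \<open>On the support of the translated vector \<open>h\<close> lies in the left coset of
  \<open>g + s\<close> modulo the stabilizer of \<open>x\<close>. So \<open>act h x\<close> is
  constant there and multiplication by \<open>f\<close> is a scalar.\<close>

lemma covrep_fibre_vec:
  assumes "finite {h. \<xi> h \<noteq> 0}" "\<And>h. \<xi> h \<noteq> 0 \<Longrightarrow> h \<in> stabilizer act x"
  shows "covrep act f g (fibre_vec x (\<lambda>h. \<xi> (- s + h)))
    = (\<lambda>p. f (act (g + s) x) * fibre_vec x (\<lambda>h. \<xi> (- (g + s) + h)) p)"
proof -
  have l2: "fibre_vec x (\<lambda>h. \<xi> (- s + h)) \<in> l2"
    by (rule fibre_vec_l2) (rule finite_supp_translate[OF assms(1)])
  have eq: "act h x = act (g + s) x" if "\<xi> (- (g + s) + h) \<noteq> 0" for h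
  proof -
    have "act (- (g + s) + h) x = x" using assms(2)[OF that] by (simp add: stabilizer_def)
    then have "act (g + s) (act (- (g + s) + h) x) = act (g + s) x" by simp
    then show ?thesis by (simp only: act_add[symmetric] add.assoc[symmetric] right_minus add_0)
  qed
  have "f (act h x) * complex_of_real (\<xi> (- (g + s) + h))
      = f (act (g + s) x) * complex_of_real (\<xi> (- (g + s) + h))" for h
    using eq[of h] by (cases "\<xi> (- (g + s) + h) = 0") auto
  moreover have "- s + (- g + h) = - (g + s) + h" for h
    by (simp only: minus_add add.assoc)
  ultimately show ?thesis
    unfolding covrep_apply[OF l2] by (auto simp: fun_eq_iff fibre_vec_def)
qed

theorem not_simple_if_almost_inv:
  assumes U: "open U" "z \<in> U" and g: "g \<noteq> 0" "\<And>y. y \<in> U \<Longrightarrow> act g y = y"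
    and ai: "\<And>n::nat. \<exists>m\<in>fin_means (stabilizer act x). almost_inv m (F n) (1 / Suc n)"
    and F: "\<And>s. act s x \<in> U \<Longrightarrow> \<forall>\<^sub>F n in sequentially. - s + g + s \<in> F n"
  shows "\<not> simple_op_algebra red"
proof
  assume simple: "simple_op_algebra red"
  have "\<forall>n. \<exists>\<xi>. (\<forall>h. \<xi> h \<noteq> 0 \<longrightarrow> h \<in> stabilizer act x) \<and> finite {h. \<xi> h \<noteq> 0} \<and> sq_sum \<xi> = 1 \<and>
      (\<forall>f\<in>F n. sq_sum (\<lambda>h. \<xi> (- f + h) - \<xi> h) \<le> 1 / Suc n)"
  proof
    fix n
    obtain m where m: "m \<in> fin_means (stabilizer act x)" "almost_inv m (F n) (1 / Suc n)" using ai by blast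
    show "\<exists>\<xi>. (\<forall>h. \<xi> h \<noteq> 0 \<longrightarrow> h \<in> stabilizer act x) \<and> finite {h. \<xi> h \<noteq> 0} \<and> sq_sum \<xi> = 1 \<and>
      (\<forall>f\<in>F n. sq_sum (\<lambda>h. \<xi> (- f + h) - \<xi> h) \<le> 1 / Suc n)"
      by (rule almost_inv_vector[OF m]) blast
  qed
  then obtain \<xi> where \<xi>: "\<And>n h. \<xi> n h \<noteq> 0 \<Longrightarrow> h \<in> stabilizer act x" "\<And>n. finite {h. \<xi> n h \<noteq> 0}"
      "\<And>n. sq_sum (\<xi> n) = 1" "\<And>n f. f \<in> F n \<Longrightarrow> sq_sum (\<lambda>h. \<xi> n (- f + h) - \<xi> n h) \<le> 1 / Suc n"
    unfolding choice_iff by blast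
  define v where "v = (\<lambda>s n. fibre_vec x (\<lambda>h. \<xi> n (- s + h)))"
  have fin: "finite {h. \<xi> n (- s + h) \<noteq> 0}" for s n by (rule finite_supp_translate[OF \<xi>(2)])
  have v_l2: "v s n \<in> l2" for s n unfolding v_def by (rule fibre_vec_l2[OF fin])
  have v_norm: "l2norm (v s n) = 1" for s n
    unfolding v_def by (subst l2norm_fibre_vec[OF fin]) (simp add: sq_sum_translate \<xi>(3))
  have cov: "covrep act f k (v s n) = (\<lambda>p. f (act (k + s) x) * v (k + s) n p)" for f k s n
    unfolding v_def by (rule covrep_fibre_vec[OF \<xi>(2,1)])
  define I where "I = {T \<in> red. \<forall>s. (\<lambda>n. l2norm (T (v s n))) \<longlonglongrightarrow> 0}"
  have "closed_ideal red I"
    unfolding I_def using v_l2 v_norm cov by (intro closed_ideal_vanishing) auto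
  then have cases: "I = {\<lambda>_ _. 0} \<or> I = red" using simple unfolding simple_op_algebra_def by blast
  obtain f :: "'x \<Rightarrow> complex" where f: "continuous_on UNIV f" "f z = 1" "\<And>y. y \<notin> U \<Longrightarrow> f y = 0"
    using ex_bump_function[OF compact U] by blast
  have cov_red: "covrep act f' k \<in> red" if "continuous_on UNIV f'" for f' k
    using covrep_in_crossed_alg[OF that] crossed_alg_subset_red by blast
  define T where "T = (\<lambda>\<xi> p. covrep act f 0 \<xi> p + (- 1) * covrep act f g \<xi> p)"
  have "T \<in> red" unfolding T_def by (intro red_add red_cmult cov_red f)
  moreover have "(\<lambda>n. l2norm (T (v s n))) \<longlonglongrightarrow> 0" for s
  proof (cases "act s x \<in> U")
    case False
    \<comment> \<open>The second term of \<open>T\<close> involves the value of \<open>f\<close> at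
      this point. As \<open>g\<close> fixes \<open>U\<close> pointwise, it cannot carry a point from
      outside into \<open>U\<close>.\<close>
    have "act (g + s) x \<notin> U"
    proof
      assume "act (g + s) x \<in> U"
      then have "act g (act (g + s) x) = act (g + s) x" by (rule g(2))
      then have "act (- g) (act g (act g (act s x))) = act (- g) (act g (act s x))" by (simp add: act_add)
      then show False using False \<open>act (g + s) x \<in> U\<close> by (simp add: act_add)
    qed
    then have "T (v s n) = (\<lambda>_. 0)" for n using False f(3) by (simp add: T_def cov)
    then show ?thesis by (simp add: l2norm_zero)
  next
    case True
    \<comment> \<open>Chosen so that \<open>g + s = s + c\<close>. Since \<open>g\<close> fixes
      \<open>act s x\<close>, both terms of \<open>T\<close> carry the coefficient
      \<open>f y\<close>, and what remains is the displacement of \<open>\<xi> n\<close> by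
      \<open>c\<close>.\<close>
    define c where "c = - s + g + s"
    define y where "y = act s x"
    have y: "act (g + s) x = y" using g(2)[OF True] by (simp add: y_def act_add)
    have norm: "l2norm (T (v s n)) = cmod (f y) * sqrt (sq_sum (\<lambda>h. \<xi> n (- c + h) - \<xi> n h))" for n
    proof -
      define \<eta> where "\<eta> = (\<lambda>h. \<xi> n (- (g + s) + h) - \<xi> n (- s + h))"
      have fin\<eta>: "finite {h. \<eta> h \<noteq> 0}"
        by (rule finite_subset[OF _ finite_UnI[OF fin[of n "g + s"] fin[of n s]]]) (auto simp: \<eta>_def)
      have "T (v s n) = (\<lambda>p. (- f y) * fibre_vec x \<eta> p)"
        unfolding T_def cov by (auto simp: y v_def fibre_vec_def \<eta>_def fun_eq_iff algebra_simps y_def[symmetric])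
      then have "l2norm (T (v s n)) = cmod (f y) * sqrt (sq_sum \<eta>)"
        by (simp only: l2norm_cmult[OF fibre_vec_l2[OF fin\<eta>]] l2norm_fibre_vec[OF fin\<eta>] norm_minus_cancel)
      also have "sq_sum \<eta> = sq_sum (\<lambda>h. \<eta> (s + h))" by (rule sq_sum_translate[symmetric])
      also have "(\<lambda>h. \<eta> (s + h)) = (\<lambda>h. \<xi> n (- c + h) - \<xi> n h)"
      proof
        fix h
        have "- (g + s) + (s + h) = - c + h" by (simp add: c_def minus_add add.assoc[symmetric] diff_conv_add_uminus del: add_uminus_conv_diff)
        then show "\<eta> (s + h) = \<xi> n (- c + h) - \<xi> n h" by (simp add: \<eta>_def)
      qed
      finally show ?thesis .
    qed
    have "(\<lambda>n. sq_sum (\<lambda>h. \<xi> n (- c + h) - \<xi> n h)) \<longlonglongrightarrow> 0"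
    proof (rule tendsto_sandwich[of "\<lambda>_. 0", OF _ _ tendsto_const])
      show "\<forall>\<^sub>F n in sequentially. sq_sum (\<lambda>h. \<xi> n (- c + h) - \<xi> n h) \<le> 1 / Suc n"
        using F[OF True] by eventually_elim (rule \<xi>(4), simp add: c_def)
      show "(\<lambda>n. 1 / Suc n) \<longlonglongrightarrow> 0" using LIMSEQ_inverse_real_of_nat by (simp add: inverse_eq_divide)
    qed (simp add: sq_sum_nonneg)
    then have "(\<lambda>n. sqrt (sq_sum (\<lambda>h. \<xi> n (- c + h) - \<xi> n h))) \<longlonglongrightarrow> 0" using tendsto_real_sqrt by fastforce
    then show ?thesis unfolding norm by (rule tendsto_mult_right_zero)
  qed
  ultimately have "T \<in> I" by (simp add: I_def)
  moreover have "T \<noteq> (\<lambda>_ _. 0)"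
  proof
    \<comment> \<open>Evaluated at \<open>(0, z)\<close>: the translate by \<open>g\<close> has
      moved the point mass away since \<open>g \<noteq> 0\<close>, which leaves
      \<open>f z = 1\<close>.\<close>
    define \<delta> :: "'g \<Rightarrow> real" where "\<delta> = (\<lambda>h. if h = 0 then 1 else 0)"
    have "fibre_vec z \<delta> \<in> l2" by (rule fibre_vec_l2) (simp add: \<delta>_def)
    then have "T (fibre_vec z \<delta>) (0, z) = 1"
      using g(1) f(2) by (simp add: T_def covrep_apply fibre_vec_def \<delta>_def act_zero)
    moreover assume "T = (\<lambda>_ _. 0)"
    ultimately show False by simp
  qed
  ultimately have "I = red" using cases by blast
  \<comment> \<open>This operator is the identity on \<open>l2\<close>, so it keeps the vectors at
    norm one.\<close>
  then have "covrep act (\<lambda>_. 1) 0 \<in> I" using cov_red[of "\<lambda>_. 1" 0] by simp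
  then have "(\<lambda>n. l2norm (covrep act (\<lambda>_. 1) 0 (v 0 n))) \<longlonglongrightarrow> 0" by (simp add: I_def)
  then have "(\<lambda>n::nat. 1::real) \<longlonglongrightarrow> 0" by (simp add: cov v_norm)
  then show False using LIMSEQ_unique[OF tendsto_const] by fastforce
qed

end

section \<open>Radicals of the stabilizers\<close>

text \<open>A plain union rather than a generated subgroup: for a subgroup \<open>H\<close> the
  family is directed, since sums of two members are again members.\<close>

definition reiter_radical :: "'g::group_add set \<Rightarrow> 'g set" where
  "reiter_radical H = \<Union> {N. normal_subgrp N H \<and> reiter N}"

lemma reiter_zero: "reiter ({0} :: 'g::group_add set)"
  unfolding reiter_def
proof (intro allI impI, elim conjE)
  fix F :: "'g set" and \<epsilon> :: real assume F: "F \<subseteq> {0}" "0 < \<epsilon>"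
  have "(\<lambda>\<phi>. \<Sum>i\<in>{0}. 1 * \<phi> i) \<in> fin_means (UNIV :: 'g set)"
    by (rule fin_meansI[of _ "\<lambda>x. x"]) auto
  moreover have "almost_inv (\<lambda>\<phi>. \<Sum>i\<in>{0}. 1 * \<phi> i) F \<epsilon>"
    using F by (auto simp: almost_inv_def)
  ultimately show "\<exists>m\<in>fin_means UNIV. almost_inv m F \<epsilon>" by blast
qed

lemma normal_subgrp_conj_minus:
  assumes "normal_subgrp N H" "subgrp H" "a \<in> N" "b \<in> H"
  shows "- b + a + b \<in> N"
proof -
  have "- b \<in> H" using assms by (simp add: subgrp_def)
  then have "- b + a - (- b) \<in> N" using assms by (auto simp: normal_subgrp_def)
  then show ?thesis by simp
qed

lemma normal_subgrp_sum:
  fixes H :: "'g::group_add set"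
  assumes "normal_subgrp N1 H" "normal_subgrp N2 H" "subgrp H"
  shows "normal_subgrp {a + b | a b. a \<in> N1 \<and> b \<in> N2} H" (is "normal_subgrp ?N H")
proof -
  have N1: "subgrp N1" "N1 \<subseteq> H" and N2: "subgrp N2" "N2 \<subseteq> H"
    using assms by (auto simp: normal_subgrp_def)
  have c1: "h + a - h \<in> N1" if "h \<in> H" "a \<in> N1" for h a using assms that by (simp add: normal_subgrp_def)
  have c2: "h + a - h \<in> N2" if "h \<in> H" "a \<in> N2" for h a using assms that by (simp add: normal_subgrp_def)
  have I: "a + b \<in> ?N" if "a \<in> N1" "b \<in> N2" for a b using that by blast
  have "subgrp ?N"
    unfolding subgrp_def
  proof (intro conjI ballI)
    show "0 \<in> ?N" using I[of 0 0] N1 N2 by (simp add: subgrp_def)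
  next
    fix x y assume "x \<in> ?N" "y \<in> ?N"
    then obtain a b a' b' where *: "x = a + b" "a \<in> N1" "b \<in> N2" "y = a' + b'" "a' \<in> N1" "b' \<in> N2" by blast
    have "x + y = (a + (b + a' - b)) + (b + b')"
      by (simp add: * diff_conv_add_uminus add.assoc del: add_uminus_conv_diff)
    moreover have "a + (b + a' - b) \<in> N1" "b + b' \<in> N2"
      using * N1 N2 c1[of b a'] by (auto simp: subgrp_def)
    ultimately show "x + y \<in> ?N" using I by simp
  next
    fix x assume "x \<in> ?N"
    then obtain a b where *: "x = a + b" "a \<in> N1" "b \<in> N2" by blast
    have "- x = (- b + - a - - b) + - b"
      by (simp add: * minus_add diff_conv_add_uminus add.assoc del: add_uminus_conv_diff)
    moreover have "- b \<in> N2" "- b \<in> H" "- a \<in> N1" using * N1 N2 by (auto simp: subgrp_def)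
    ultimately show "- x \<in> ?N" using I[OF c1, of "- b" "- a" "- b"] by simp
  qed
  moreover have "?N \<subseteq> H" using N1(2) N2(2) assms(3) unfolding subgrp_def by blast
  moreover have "h + x - h \<in> ?N" if h: "h \<in> H" and x: "x \<in> ?N" for h x
  proof -
    obtain a b where *: "x = a + b" "a \<in> N1" "b \<in> N2" using x by blast
    have "h + x - h = (h + a - h) + (h + b - h)"
      by (simp add: * diff_conv_add_uminus add.assoc del: add_uminus_conv_diff)
    then show ?thesis using I[OF c1 c2, of h a h b] * h by simp
  qed
  ultimately show ?thesis by (simp add: normal_subgrp_def)
qed

text \<open>Each new element contributes a normal subgroup, which is added to the one found so far.
  A common \<open>N\<close> is what lets one mean serve all of \<open>F\<close>.\<close>

lemma finite_subset_reiter_radical: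
  assumes "finite F" "F \<subseteq> reiter_radical H" "subgrp H"
  obtains N where "normal_subgrp N H" "reiter N" "F \<subseteq> N"
proof -
  have "\<exists>N. normal_subgrp N H \<and> reiter N \<and> F \<subseteq> N" using assms(1,2)
  proof (induction F rule: finite_induct)
    case empty
    have "normal_subgrp {0} H" using assms(3) by (auto simp: normal_subgrp_def subgrp_def)
    then show ?case using reiter_zero by blast
  next
    case (insert g F)
    then obtain N1 where N1: "normal_subgrp N1 H" "reiter N1" "F \<subseteq> N1" by auto
    obtain N2 where N2: "normal_subgrp N2 H" "reiter N2" "g \<in> N2"
      using insert.prems by (auto simp: reiter_radical_def)
    have z: "0 \<in> N1" "0 \<in> N2" and N2': "subgrp N2" "N2 \<subseteq> H"
      using N1 N2 by (auto simp: normal_subgrp_def subgrp_def)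
    have "reiter {a + b | a b. a \<in> N1 \<and> b \<in> N2}"
      using N2'(2) normal_subgrp_conj_minus[OF N1(1) assms(3)]
      by (intro reiter_sum N1 N2 N2') auto
    moreover have "insert g F \<subseteq> {a + b | a b. a \<in> N1 \<and> b \<in> N2}"
    proof
      fix f assume "f \<in> insert g F"
      then have "(f = 0 + f \<and> f \<in> N2) \<or> (f = f + 0 \<and> f \<in> N1)" using N1 N2 by auto
      then show "f \<in> {a + b | a b. a \<in> N1 \<and> b \<in> N2}" using z by blast
    qed
    ultimately show ?case using normal_subgrp_sum[OF N1(1) N2(1) assms(3)] by blast
  qed
  then show thesis using that by blast
qed

text \<open>Otherwise \<open>{0}\<close> would be one of the subgroups intersected in
  \<open>amenable_radical\<close>.\<close>

lemma ex_reiter_radical_nonzero: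
  fixes H :: "'g::{group_add, countable} set"
  assumes "amenable_radical H \<noteq> {0}"
  shows "\<exists>g\<in>reiter_radical H. g \<noteq> 0"
proof (rule ccontr)
  assume no: "\<not> ?thesis"
  have "\<Union> {N. normal_subgrp N H \<and> amenable_subgrp N} \<subseteq> reiter_radical H"
    unfolding reiter_radical_def using amenable_imp_reiter by blast
  with no have "\<Union> {N. normal_subgrp N H \<and> amenable_subgrp N} \<subseteq> {0}" by auto
  then have "amenable_radical H \<subseteq> {0}"
    unfolding amenable_radical_def by (intro Inter_lower) (simp add: subgrp_def)
  moreover have "0 \<in> amenable_radical H" by (simp add: amenable_radical_def subgrp_def)
  ultimately show False using assms by blast
qed

section \<open>Tame points and limits of radicals\<close>

context compact_action
begin

lemma subgrp_stabilizer: "subgrp (stabilizer act x)"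
proof -
  have "act (- g) x = x" if "act g x = x" for g using act_uminus(1)[of g x] that by simp
  then show ?thesis by (auto simp: subgrp_def stabilizer_def act_zero act_add)
qed

lemma open_vimage_act: "open V \<Longrightarrow> open {y. act g y \<in> V}"
  using continuous_on_open_vimage[of UNIV "act g"] continuous_act by (simp add: vimage_def)

lemma closed_fixed_points: "closed {y. act g y = y}"
  by (rule closed_Collect_eq) (auto intro: continuous_act)

text \<open>The complement is the union over \<open>h\<close> of the fixed sets minus their
  interiors, which are closed and nowhere dense.\<close>

definition tame :: "'x \<Rightarrow> bool" where
  "tame x \<longleftrightarrow> (\<forall>h. act h x = x \<longrightarrow> x \<in> interior {y. act h y = y})"

lemma tame_act:
  assumes "tame x"
  shows "tame (act s x)"
  unfolding tame_def
proof (intro allI impI)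
  fix h assume "act h (act s x) = act s x"
  then have "act (- s) (act h (act s x)) = x" by simp
  then have "act (- s + h + s) x = x" by (simp add: act_add)
  then have x: "x \<in> interior {y. act (- s + h + s) y = y}" using assms by (simp add: tame_def)
  have "{y. act (- s) y \<in> interior {y. act (- s + h + s) y = y}} \<subseteq> {y. act h y = y}"
  proof clarify
    fix y assume "act (- s) y \<in> interior {y. act (- s + h + s) y = y}"
    then have "act (- s + h + s) (act (- s) y) = act (- s) y" using interior_subset by blast
    then have "act s (act (- s) (act h (act s (act (- s) y)))) = act s (act (- s) y)" by (simp add: act_add)
    then show "act h y = y" by simp
  qed
  moreover have "open {y. act (- s) y \<in> interior {y. act (- s + h + s) y = y}}"
    by (rule open_vimage_act) simp
  ultimately show "act s x \<in> interior {y. act h y = y}"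
    using x by (intro interiorI[where T = "{y. act (- s) y \<in> interior {y. act (- s + h + s) y = y}}"]) auto
qed

text \<open>Conjugation by \<open>s\<close> identifies the stabilizers of \<open>act s x\<close> and
  \<open>x\<close>, and it respects normality and Reiter's condition.\<close>

lemma reiter_radical_conj:
  assumes "g \<in> reiter_radical (stabilizer act (act s x))"
  shows "- s + g + s \<in> reiter_radical (stabilizer act x)"
proof -
  obtain N where N: "normal_subgrp N (stabilizer act (act s x))" "reiter N" "g \<in> N"
    using assms by (auto simp: reiter_radical_def)
  let ?c = "\<lambda>n. - s + n + s"
  have sub: "subgrp N" "N \<subseteq> stabilizer act (act s x)"
    and conj: "\<And>h n. h \<in> stabilizer act (act s x) \<Longrightarrow> n \<in> N \<Longrightarrow> h + n - h \<in> N"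
    using N(1) by (auto simp: normal_subgrp_def)
  have "subgrp (?c ` N)"
    unfolding subgrp_def
  proof (intro conjI ballI)
    have "?c 0 \<in> ?c ` N" using sub by (intro imageI) (simp add: subgrp_def)
    then show "0 \<in> ?c ` N" by simp
    show "a + b \<in> ?c ` N" if ab: "a \<in> ?c ` N" "b \<in> ?c ` N" for a b
    proof -
      obtain n n' where "n \<in> N" "a = ?c n" "n' \<in> N" "b = ?c n'" using ab by blast
      moreover from this have "a + b = ?c (n + n')"
        by (simp add: add.assoc)
      ultimately show ?thesis using sub by (auto simp: subgrp_def)
    qed
    show "- a \<in> ?c ` N" if a: "a \<in> ?c ` N" for a
    proof -
      obtain n where n: "n \<in> N" "a = ?c n" using a by blast
      then have "- a = ?c (- n)"
        by (simp add: minus_add diff_conv_add_uminus add.assoc del: add_uminus_conv_diff)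
      moreover have "- n \<in> N" using sub n by (simp add: subgrp_def)
      ultimately show ?thesis by blast
    qed
  qed
  moreover have "?c ` N \<subseteq> stabilizer act x"
    using sub(2) by (auto simp: stabilizer_def act_add)
  moreover have "h + a - h \<in> ?c ` N" if h: "h \<in> stabilizer act x" and a: "a \<in> ?c ` N" for h a
  proof -
    obtain n where n: "n \<in> N" "a = ?c n" using a by blast
    have "s + h + - s \<in> stabilizer act (act s x)" using h by (simp add: stabilizer_def act_add del: add_uminus_conv_diff)
    then have "(s + h + - s) + n - (s + h + - s) \<in> N" using conj n(1) by blast
    moreover have "h + a - h = ?c ((s + h + - s) + n - (s + h + - s))"
      by (simp add: n minus_add diff_conv_add_uminus add.assoc del: add_uminus_conv_diff)
    ultimately show ?thesis by blast
  qed
  ultimately have "normal_subgrp (?c ` N) (stabilizer act x)" by (simp add: normal_subgrp_def)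
  then show ?thesis
    unfolding reiter_radical_def using reiter_conjugate[OF N(2)] N(3) by blast
qed

text \<open>The elements lying in chosen normal subgroups of the stabilizers of all relevant points
  near \<open>x\<close> form a normal subgroup of the stabilizer of \<open>x\<close>, because a tame point has every element
  of its stabilizer in all nearby stabilizers.\<close>
lemma reiter_radical_closed:
  assumes "tame x" "x \<in> closure {y. g \<in> reiter_radical (stabilizer act y)}" (is "x \<in> closure ?E")
  shows "g \<in> reiter_radical (stabilizer act x)"
proof -
  have "\<forall>y\<in>?E. \<exists>N. normal_subgrp N (stabilizer act y) \<and> reiter N \<and> g \<in> N"
    by (auto simp: reiter_radical_def)
  then obtain N where N: "\<And>y. y \<in> ?E \<Longrightarrow> normal_subgrp (N y) (stabilizer act y) \<and> reiter (N y) \<and> g \<in> N y"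
    by metis
  \<comment> \<open>The limit inferior of the groups \<open>N y\<close> as \<open>y\<close>
    approaches \<open>x\<close> within \<open>?E\<close>.\<close>
  define L where "L = {l. \<forall>\<^sub>F y in nhds x. y \<in> ?E \<longrightarrow> l \<in> N y}"
  have LI: "l \<in> L" if "\<forall>\<^sub>F y in nhds x. y \<in> ?E \<longrightarrow> l \<in> N y" for l using that by (simp add: L_def)
  have LD: "\<forall>\<^sub>F y in nhds x. y \<in> ?E \<longrightarrow> l \<in> N y" if "l \<in> L" for l using that by (simp add: L_def)
  have sub: "subgrp (N y)" "N y \<subseteq> stabilizer act y" if "y \<in> ?E" for y
    using N[OF that] by (auto simp: normal_subgrp_def)
  \<comment> \<open>As \<open>x\<close> is in the closure of \<open>?E\<close>, whatever holds near
    \<open>x\<close> holds at some point of \<open>?E\<close>.\<close>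
  have ex: "\<exists>y\<in>?E. P y" if "\<forall>\<^sub>F y in nhds x. P y" for P
  proof -
    obtain S where S: "open S" "x \<in> S" "\<forall>y\<in>S. P y" using \<open>\<forall>\<^sub>F y in nhds x. P y\<close> by (auto simp: eventually_nhds)
    then have "S \<inter> ?E \<noteq> {}" using assms(2) open_Int_closure_eq_empty[OF S(1)] by blast
    then show ?thesis using S by blast
  qed
  have "subgrp L"
    unfolding subgrp_def
  proof (intro conjI ballI)
    show "0 \<in> L" using sub by (intro LI always_eventually) (auto simp: subgrp_def)
    show "a + b \<in> L" if "a \<in> L" "b \<in> L" for a b
    proof (rule LI)
      show "\<forall>\<^sub>F y in nhds x. y \<in> ?E \<longrightarrow> a + b \<in> N y"
        using LD[OF that(1)] LD[OF that(2)] by eventually_elim (use sub(1) in \<open>auto simp: subgrp_def\<close>)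
    qed
    show "- a \<in> L" if "a \<in> L" for a
    proof (rule LI)
      show "\<forall>\<^sub>F y in nhds x. y \<in> ?E \<longrightarrow> - a \<in> N y"
        using LD[OF that] by eventually_elim (use sub(1) in \<open>auto simp: subgrp_def\<close>)
    qed
  qed
  moreover have "L \<subseteq> stabilizer act x"
  proof
    fix l assume l: "l \<in> L"
    \<comment> \<open>Fixed sets are closed: if \<open>l\<close> moved \<open>x\<close>, it would
      move all nearby points, including some \<open>y\<close> with \<open>l\<close> in its
      stabilizer.\<close>
    have "x \<in> {y. act l y = y}"
    proof (rule ccontr)
      assume "x \<notin> {y. act l y = y}"
      then have "\<forall>\<^sub>F y in nhds x. y \<in> - {y. act l y = y}"
        by (intro eventually_nhds_in_open) (auto simp: closed_fixed_points open_Compl)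
      with LD[OF l] have "\<forall>\<^sub>F y in nhds x. (y \<in> ?E \<longrightarrow> l \<in> N y) \<and> y \<in> - {y. act l y = y}"
        by (rule eventually_conj)
      from ex[OF this] obtain y where "y \<in> ?E" "l \<in> N y" "act l y \<noteq> y" by auto
      then show False using sub(2)[of y] by (auto simp: stabilizer_def)
    qed
    then show "l \<in> stabilizer act x" by (simp add: stabilizer_def)
  qed
  moreover have "h + l - h \<in> L" if h: "h \<in> stabilizer act x" and l: "l \<in> L" for h l
  proof -
    \<comment> \<open>Tameness puts \<open>h\<close> into the stabilizers of all nearby
      \<open>y\<close>, where normality of \<open>N y\<close> applies.\<close>
    have "x \<in> interior {y. act h y = y}" using assms(1) h by (auto simp: tame_def stabilizer_def)
    then have "\<forall>\<^sub>F y in nhds x. y \<in> interior {y. act h y = y}" by (intro eventually_nhds_in_open) auto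
    with LD[OF l] have "\<forall>\<^sub>F y in nhds x. y \<in> ?E \<longrightarrow> h + l - h \<in> N y"
    proof eventually_elim
      case (elim y)
      show ?case
      proof
        assume y: "y \<in> ?E"
        have "act h y = y" using elim(2) interior_subset by blast
        then show "h + l - h \<in> N y" using N[OF y] elim(1) y by (auto simp: normal_subgrp_def stabilizer_def)
      qed
    qed
    then show ?thesis by (rule LI)
  qed
  ultimately have "normal_subgrp L (stabilizer act x)" by (simp add: normal_subgrp_def)
  moreover have "reiter L"
  proof (rule reiter_local)
    fix F assume F: "finite F" "F \<subseteq> L"
    then have "\<forall>\<^sub>F y in nhds x. \<forall>l\<in>F. y \<in> ?E \<longrightarrow> l \<in> N y"
      using LD by (intro eventually_ball_finite) auto
    \<comment> \<open>One \<open>y\<close> serves the whole finite set \<open>F\<close>, but it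
      varies with \<open>F\<close>; this is why \<open>reiter_local\<close> is invoked.\<close>
    from ex[OF this] obtain y where "y \<in> ?E" "F \<subseteq> N y" by blast
    then show "\<exists>N. reiter N \<and> F \<subseteq> N" using N by blast
  qed
  moreover have "g \<in> L" using N by (intro LI always_eventually) blast
  ultimately show ?thesis by (auto simp: reiter_radical_def)
qed

section \<open>The category argument and the conclusion\<close>

lemma Baire_compact:
  fixes \<G> :: "'x set set"
  assumes "countable \<G>" "\<And>T. T \<in> \<G> \<Longrightarrow> closed T \<and> interior T = {}"
  shows "\<Union>\<G> \<noteq> UNIV"
proof
  assume U: "\<Union>\<G> = UNIV"
  have c: "compact_space (euclidean :: 'x topology)" using compact by (simp add: compact_space_def)
  have "euclidean interior_of \<Union>\<G> = {}"
  proof (rule Baire_category_alt)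
    show "completely_metrizable_space (euclidean :: 'x topology) \<or>
        locally_compact_space (euclidean :: 'x topology) \<and> regular_space (euclidean :: 'x topology)"
      using c compact_imp_locally_compact_space compact_Hausdorff_imp_regular_space
        Hausdorff_space_euclidean_t2 by blast
  qed (use assms in auto)
  then show False using U by simp
qed

lemma nowhere_dense_not_tame: "interior ({y. act h y = y} - interior {y. act h y = y}) = {}"
proof -
  have "interior ({y. act h y = y} - interior {y. act h y = y}) \<subseteq> interior {y. act h y = y}"
    by (rule interior_mono) auto
  then show ?thesis using interior_subset by blast
qed

lemma closed_not_tame: "closed ({y. act h y = y} - interior {y. act h y = y})"
  by (intro closed_Diff closed_fixed_points) simp

end

theorem not_simple_if_radicals_nontrivial:
  fixes act :: "'g::{group_add, countable} \<Rightarrow> 'x::t2_space \<Rightarrow> 'x"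
  assumes "compact_action act" and nontriv: "\<And>x. amenable_radical (stabilizer act x) \<noteq> {0}"
  shows "\<not> simple_op_algebra (reduced_crossed_product act)"
proof -
  interpret compact_action act by fact
  let ?B = "\<lambda>h. {y. act h y = y} - interior {y. act h y = y}"
  let ?E = "\<lambda>g. {y. g \<in> reiter_radical (stabilizer act y)}"
  have not_tame: "\<exists>h. y \<in> ?B h" if "\<not> tame y" for y using that by (auto simp: tame_def)
  obtain x where x: "tame x"
  proof -
    have "\<Union> (range ?B) \<noteq> UNIV"
      by (rule Baire_compact) (auto simp: nowhere_dense_not_tame closed_not_tame)
    then show thesis using not_tame that by blast
  qed
  obtain g where g: "g \<noteq> 0" "interior (closure (?E g)) \<noteq> {}"
  proof (rule ccontr)
    assume no: "\<not> thesis"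
    have "\<Union> (range ?B \<union> (\<lambda>g. closure (?E g)) ` (- {0})) \<noteq> UNIV"
      by (rule Baire_compact) (use no that in \<open>auto simp: nowhere_dense_not_tame closed_not_tame\<close>)
    then obtain y where y: "\<And>h. y \<notin> ?B h" "\<And>g. g \<noteq> 0 \<Longrightarrow> y \<notin> closure (?E g)" by blast
    \<comment> \<open>The radical at \<open>y\<close> contains some nonzero \<open>k\<close>, so
      \<open>y\<close> lies in \<open>?E k\<close> and cannot avoid its closure.\<close>
    obtain k where "k \<in> reiter_radical (stabilizer act y)" "k \<noteq> 0"
      using ex_reiter_radical_nonzero[OF nontriv[of y]] by blast
    then have "y \<in> closure (?E k)" by (intro subsetD[OF closure_subset]) simp
    then show False using y(2)[OF \<open>k \<noteq> 0\<close>] by contradiction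
  qed
  define U where "U = interior (closure (?E g))"
  obtain z where z: "z \<in> U" using g by (auto simp: U_def)
  have "closure (?E g) \<subseteq> {y. act g y = y}"
    by (rule closure_minimal[OF _ closed_fixed_points])
      (auto simp: reiter_radical_def normal_subgrp_def stabilizer_def)
  then have fixU: "act g y = y" if "y \<in> U" for y
    using that interior_subset unfolding U_def by blast
  \<comment> \<open>\<open>U\<close> is only inside the closure of \<open>?E g\<close>; tameness of
    \<open>act s x\<close> brings that point back into \<open>?E g\<close>, and conjugation
    transports the membership to \<open>x\<close>.\<close>
  have rad: "- s + g + s \<in> reiter_radical (stabilizer act x)" if "act s x \<in> U" for s
  proof (rule reiter_radical_conj, rule reiter_radical_closed)
    show "tame (act s x)" by (rule tame_act[OF x])
    show "act s x \<in> closure (?E g)" using that interior_subset unfolding U_def by blast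
  qed
  \<comment> \<open>A finite exhaustion, through \<open>to_nat\<close>, of a possibly infinite set
    of conjugates: each \<open>F n\<close> fits into one Reiter subgroup, and every conjugate is
    eventually included.\<close>
  define F where "F = (\<lambda>n. {c. to_nat c \<le> n \<and> (\<exists>s. act s x \<in> U \<and> c = - s + g + s)})"
  show ?thesis
  proof (rule not_simple_if_almost_inv[of U z g x F])
    fix n :: nat
    have "finite (to_nat -` {..n} :: 'g set)" by (rule finite_vimageI) auto
    moreover have "F n \<subseteq> to_nat -` {..n}" by (auto simp: F_def)
    ultimately have fin: "finite (F n)" by (rule rev_finite_subset)
    have "F n \<subseteq> reiter_radical (stabilizer act x)" using rad by (auto simp: F_def)
    then obtain N where N: "normal_subgrp N (stabilizer act x)" "reiter N" "F n \<subseteq> N"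
      using finite_subset_reiter_radical[OF fin _ subgrp_stabilizer] by blast
    have "F n \<subseteq> stabilizer act x" using N by (auto simp: normal_subgrp_def)
    then obtain m where "m \<in> fin_means (stabilizer act x)" "almost_inv m (F n) (1 / Suc n)"
      using reiter_fin_means_subgrp[OF N(2) subgrp_stabilizer fin N(3), of x "1 / Suc n"] by auto
    then show "\<exists>m\<in>fin_means (stabilizer act x). almost_inv m (F n) (1 / Suc n)" by blast
  next
    fix s assume "act s x \<in> U"
    then have "- s + g + s \<in> F n" if "to_nat (- s + g + s) \<le> n" for n using that by (auto simp: F_def)
    then show "\<forall>\<^sub>F n in sequentially. - s + g + s \<in> F n"
      unfolding eventually_sequentially by blast
  qed (use z g fixU in \<open>auto simp: U_def\<close>)
qed

theorem theoremA:
  fixes act :: "'g::{group_add, countable} \<Rightarrow> 'x::t2_space \<Rightarrow> 'x"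
  assumes "compact (UNIV :: 'x set)"
    and "\<And>x. act 0 x = x"
    and "\<And>g h x. act (g + h) x = act g (act h x)"
    and "\<And>g. homeomorphism UNIV UNIV (act g) (act (- g))"
    and "simple_op_algebra (reduced_crossed_product act)"
  shows "\<exists>x0. amenable_radical (stabilizer act x0) = {0}"
proof (rule ccontr)
  assume "\<nexists>x0. amenable_radical (stabilizer act x0) = {0}"
  then have nontriv: "amenable_radical (stabilizer act x) \<noteq> {0}" for x by simp
  have "compact_action act"
  proof (unfold_locales, fact assms(1), fact assms(2), fact assms(3))
    show "continuous_on A (act g)" for A g
      using homeomorphism_cont1[OF assms(4)] by (rule continuous_on_subset) simp
  qed
  from not_simple_if_radicals_nontrivial[OF this nontriv] assms(5) show False by contradiction
qed

end
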